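(* Let $\alpha_0,\lambda_0\in\mathbb R$ and let $u\in\mathcal S(\mathbb R)$ satisfy $\|u\|_{L^2(\mathbb R)}=1$, $u(x)=0$ if and only if $x=\lambda_0$, and $1+\alpha_0\gamma(|u|^2,\lambda_0)=0$. For $\alpha\in\mathbb R$ let $H_\alpha=M_x+\alpha\langle\cdot,u\rangle u$ on $L^2(\mathbb R)$. Let $v,w\in\mathcal S(\mathbb R)$. Then for any fixed $h\in\mathbb R$, $$\lim_{\alpha\to\alpha_0}\kappa(\alpha)\,\rho^{v,w}(\alpha,\lambda_h(\alpha))=\frac1\pi\,\frac{1}{h^2+1}\,\langle P_{\lambda_0}v,w\rangle ,$$ where $P_{\lambda_0}$ denotes the orthogonal projection onto the eigenspace of $H_{\alpha_0}$ for the eigenvalue $\lambda_0$. In particular, $$\lim_{\alpha\to\alpha_0}\kappa(\alpha)\,\rho^{\phi}(\alpha,\lambda_h(\alpha))=\frac{\|\phi\|^2}{\pi}\,\frac{1}{h^2+1}.$$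
   Context: The inner product is linear in its first argument. $M_x$ is the self-adjoint operator of multiplication by $x$ on $L^2(\mathbb R)$, with maximal domain; $H_\alpha$ has the same domain. For $f\in\mathcal S(\mathbb R)$, $\lambda\in\mathbb R$, $\gamma(f,\lambda)=\lim_{\epsilon\to0^+}\int_{|x-\lambda|\ge\epsilon}\frac{f(x)}{x-\lambda}\,dx$ (Cauchy principal value). Put $F_1(\alpha,\lambda)=1+\alpha\gamma(|u|^2,\lambda)$. The function $\phi$ is defined by $\phi(x)=u(x)/(x-\lambda_0)$ for $x\ne\lambda_0$ and $\phi(\lambda_0)=u'(\lambda_0)$; it belongs to $\mathcal S(\mathbb R)$ and is an eigenvector of $H_{\alpha_0}$ for the simple eigenvalue $\lambda_0$. Let $J$ be an open interval around $\alpha_0$ and $\lambda:J\to\mathbb R$, $\alpha\mapsto\lambda(\alpha)$, a $C^1$ function with $\lambda(\alpha_0)=\lambda_0$ and $F_1(\alpha,\lambda(\alpha))=0$ for $\alpha\in J$ (these exist by the implicit function theorem). For $\alpha\in J$, $h\in\mathbb R$ set $\kappa(\alpha)=\pi|u(\lambda(\alpha))|^2/\|\phi\|^2$ and $\lambda_h(\alpha)=\lambda(\alpha)+h\kappa(\alpha)$. For $\alpha\neq\alpha_0$ the operator $H_\alpha$ is purely absolutely continuous, and for $v,w\in\mathcal S(\mathbb R)$ the spectral density of the measure $\langle E_\alpha(d\lambda)v,w\rangle$ ($E_\alpha$ the spectral measure of $H_\alpha$) is $\rho^{v,w}(\alpha,\lambda)=\lim_{\epsilon\to0^+}\frac{1}{2\pi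 i}\big(\langle R_\alpha(\lambda+i\epsilon)v,w\rangle-\langle R_\alpha(\lambda-i\epsilon)v,w\rangle\big)$, where $R_\alpha(z)=(H_\alpha-z)^{-1}$. Write $\rho^\phi=\rho^{\phi,\phi}$. Limits $\alpha\to\alpha_0$ are over $\alpha\ne\alpha_0$. *)

theory Defs
  imports "HOL-Analysis.Analysis"
begin

text \<open>
  Elements of \<open>L\<^sup>2(\<real>)\<close> are represented by square-integrable Borel functions
  \<open>\<real> \<Rightarrow> \<complex>\<close>; equality in \<open>L\<^sup>2(\<real>)\<close> is equality almost everywhere.
  Since \<open>\<lambda>\<close> is reserved, spectral parameters are called \<open>\<mu>\<close>.
\<close>

definition L2 :: "(real \<Rightarrow> complex) set" where
  "L2 = {f. f \<in> borel_measurable lborel \<and> integrable lborel (\<lambda>x. (cmod (f x))\<^sup>2)}"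

definition l2_inner :: "(real \<Rightarrow> complex) \<Rightarrow> (real \<Rightarrow> complex) \<Rightarrow> complex" where
  "l2_inner f g = (LINT x|lborel. f x * cnj (g x))"

definition l2_norm :: "(real \<Rightarrow> complex) \<Rightarrow> real" where
  "l2_norm f = sqrt (LINT x|lborel. (cmod (f x))\<^sup>2)"

definition iter_deriv :: "nat \<Rightarrow> (real \<Rightarrow> complex) \<Rightarrow> real \<Rightarrow> complex" where
  "iter_deriv n f = ((\<lambda>g x. vector_derivative g (at x)) ^^ n) f"

definition schwartz :: "(real \<Rightarrow> complex) set" where
  "schwartz = {f. \<forall>n. (\<forall>x. iter_deriv n f differentiable (at x)) \<and>
                      (\<forall>m. bounded (range (\<lambda>x. x ^ m *\<^sub>R iter_deriv n f x)))}"

definition pv_gamma :: "(real \<Rightarrow> complex) \<Rightarrow> real \<Rightarrow> complex" where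
  "pv_gamma f \<mu> =
     Lim (at_right 0) (\<lambda>\<epsilon>. LINT x:{x. \<bar>x - \<mu>\<bar> \<ge> \<epsilon>}|lborel. f x / of_real (x - \<mu>))"

definition F1 :: "(real \<Rightarrow> complex) \<Rightarrow> real \<Rightarrow> real \<Rightarrow> complex" where
  "F1 u \<alpha> \<mu> = 1 + of_real \<alpha> * pv_gamma (\<lambda>x. of_real ((cmod (u x))\<^sup>2)) \<mu>"

text \<open>The maximal domain of multiplication by \<open>x\<close>, and \<open>H\<^sub>\<alpha> = M\<^sub>x + \<alpha>\<langle>\<cdot>,u\<rangle>u\<close>.\<close>

definition dom_M :: "(real \<Rightarrow> complex) set" where
  "dom_M = {f \<in> L2. (\<lambda>x. of_real x * f x) \<in> L2}"

definition H_op :: "(real \<Rightarrow> complex) \<Rightarrow> real \<Rightarrow> (real \<Rightarrow> complex) \<Rightarrow> real \<Rightarrow> complex" where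
  "H_op u \<alpha> f = (\<lambda>x. of_real x * f x + of_real \<alpha> * l2_inner f u * u x)"

text \<open>
  \<open>R\<^sub>\<alpha>(z)g\<close> is the solution \<open>f\<close> of \<open>(H\<^sub>\<alpha> - z)f = g\<close>. It is unique only up to null sets,
  so \<open>SOME\<close> picks one representative; inner products do not depend on the choice.
  The same applies to the projection below.
\<close>

definition resolvent ::
  "(real \<Rightarrow> complex) \<Rightarrow> real \<Rightarrow> complex \<Rightarrow> (real \<Rightarrow> complex) \<Rightarrow> real \<Rightarrow> complex" where
  "resolvent u \<alpha> z g =
     (SOME f. f \<in> dom_M \<and> (AE x in lborel. H_op u \<alpha> f x - z * f x = g x))"

definition eigenspace :: "(real \<Rightarrow> complex) \<Rightarrow> real \<Rightarrow> complex \<Rightarrow> (real \<Rightarrow> complex) set" where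
  "eigenspace u \<alpha> \<mu> = {f \<in> dom_M. AE x in lborel. H_op u \<alpha> f x = \<mu> * f x}"

definition orth_proj ::
  "(real \<Rightarrow> complex) set \<Rightarrow> (real \<Rightarrow> complex) \<Rightarrow> real \<Rightarrow> complex" where
  "orth_proj V f = (SOME p. p \<in> V \<and> (\<forall>e\<in>V. l2_inner (\<lambda>x. f x - p x) e = 0))"

text \<open>The density at \<open>\<mu>\<close> of the measure \<open>\<langle>E\<^sub>\<alpha>(d\<mu>)v,w\<rangle>\<close>, given by Stone's formula.\<close>

definition spec_density ::
  "(real \<Rightarrow> complex) \<Rightarrow> (real \<Rightarrow> complex) \<Rightarrow> (real \<Rightarrow> complex) \<Rightarrow> real \<Rightarrow> real \<Rightarrow> complex" where
  "spec_density u v w \<alpha> \<mu> =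
     Lim (at_right 0) (\<lambda>\<epsilon>. 1 / (2 * of_real pi * \<i>) *
       (l2_inner (resolvent u \<alpha> (of_real \<mu> + \<i> * of_real \<epsilon>) v) w
        - l2_inner (resolvent u \<alpha> (of_real \<mu> - \<i> * of_real \<epsilon>) v) w))"

definition phi :: "(real \<Rightarrow> complex) \<Rightarrow> real \<Rightarrow> real \<Rightarrow> complex" where
  "phi u \<mu>\<^sub>0 x = (if x = \<mu>\<^sub>0 then vector_derivative u (at \<mu>\<^sub>0) else u x / of_real (x - \<mu>\<^sub>0))"

text \<open>In the following, \<open>lam\<close> is the curve \<open>\<alpha> \<mapsto> \<lambda>(\<alpha>)\<close>.\<close>

definition kappa :: "(real \<Rightarrow> complex) \<Rightarrow> real \<Rightarrow> (real \<Rightarrow> real) \<Rightarrow> real \<Rightarrow> real" where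
  "kappa u \<mu>\<^sub>0 lam \<alpha> = pi * (cmod (u (lam \<alpha>)))\<^sup>2 / (l2_norm (phi u \<mu>\<^sub>0))\<^sup>2"

definition lam_h :: "(real \<Rightarrow> complex) \<Rightarrow> real \<Rightarrow> (real \<Rightarrow> real) \<Rightarrow> real \<Rightarrow> real \<Rightarrow> real" where
  "lam_h u \<mu>\<^sub>0 lam h \<alpha> = lam \<alpha> + h * kappa u \<mu>\<^sub>0 lam \<alpha>"

end

theory Submission
  imports Defs "HOL-Probability.Sinc_Integral"
begin

text \<open>
  By the rank-one formula for the resolvent,
  \<open>\<langle>R\<^sub>\<alpha>(z)v, w\<rangle>\<close> equals the Cauchy transform of \<open>v w\<^sup>*\<close> minus
  \<open>\<alpha>\<close> times the Cauchy transforms of \<open>v u\<^sup>*\<close> and \<open>u w\<^sup>*\<close>, divided by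
  \<open>1 + \<alpha>C(z)\<close> with \<open>C\<close> the Cauchy transform of \<open>|u|\<^sup>2\<close>.
  By the Plemelj formula, the boundary values of the denominator at \<open>\<mu>\<close> are
  \<open>F\<^sub>1(\<alpha>, \<mu>) \<plusminus> i\<pi>\<alpha>|u(\<mu>)|\<^sup>2\<close>. The derivative of \<open>\<gamma>(|u|\<^sup>2, \<cdot>)\<close> at \<open>\<mu>\<^sub>0\<close>
  is \<open>\<parallel>\<phi>\<parallel>\<^sup>2\<close>, so along \<open>\<mu> = \<lambda>\<^sub>h(\<alpha>)\<close> the denominator divided by \<open>\<kappa>(\<alpha>)\<close>
  tends to \<open>\<alpha>\<^sub>0\<parallel>\<phi>\<parallel>\<^sup>2(h \<plusminus> i)\<close>, while the two numerators tend to
  \<open>\<langle>v, \<phi>\<rangle>\<close> and \<open>\<langle>\<phi>, w\<rangle>\<close>. The zero of \<open>u\<close> may have any order; therefore the increments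
  of \<open>\<gamma>(|u|\<^sup>2, \<cdot>)\<close> and \<open>|u|\<^sup>2\<close> from \<open>\<lambda>(\<alpha>)\<close> to \<open>\<lambda>\<^sub>h(\<alpha>)\<close> are measured against
  \<open>\<kappa>(\<alpha>)\<close>, using only that both functions are continuously differentiable.
\<close>

section \<open>Lipschitz functions with polynomial decay\<close>

text \<open>One constant serves both bounds. The Lipschitz bound controls difference quotients near
  a singularity, and the weight controls infinity: \<open>k = 1\<close> gives square integrability
  and \<open>k = 2\<close> integrability. Unlike membership in the Schwartz space, this passes to
  \<open>phi\<close> without estimating all of its derivatives.\<close>

definition lip_decay :: "nat \<Rightarrow> (real \<Rightarrow> complex) \<Rightarrow> bool" where
  "lip_decay k f \<longleftrightarrow>
     (\<exists>C. \<forall>x y. cmod (f x - f y) \<le> C * \<bar>x - y\<bar> \<and> cmod (f x) * (1 + \<bar>x\<bar>) ^ k \<le> C)"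

lemma lip_decayE:
  assumes "lip_decay k f"
  obtains C where "C \<ge> 0" "\<And>x y. cmod (f x - f y) \<le> C * \<bar>x - y\<bar>"
    "\<And>x. cmod (f x) * (1 + \<bar>x\<bar>) ^ k \<le> C" "\<And>x. cmod (f x) \<le> C"
proof -
  obtain C where C: "\<And>x y. cmod (f x - f y) \<le> C * \<bar>x - y\<bar>"
    "\<And>x. cmod (f x) * (1 + \<bar>x\<bar>) ^ k \<le> C"
    using assms unfolding lip_decay_def by blast
  have "0 \<le> cmod (f 0) * (1 + \<bar>0::real\<bar>) ^ k" by simp
  then have "C \<ge> 0" using C(2)[of 0] by linarith
  moreover have "cmod (f x) \<le> C" for x
  proof -
    have "cmod (f x) * 1 \<le> cmod (f x) * (1 + \<bar>x\<bar>) ^ k"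
      by (intro mult_left_mono one_le_power) auto
    with C(2)[of x] show ?thesis by simp
  qed
  ultimately show ?thesis using C that by blast
qed

lemma lip_decay_continuous: "lip_decay k f \<Longrightarrow> continuous_on UNIV f"
proof (elim lip_decayE)
  fix C assume "0 \<le> C" "\<And>x y. cmod (f x - f y) \<le> C * \<bar>x - y\<bar>"
  then have "C-lipschitz_on UNIV f"
    by (auto simp: lipschitz_on_def dist_norm)
  then show ?thesis by (rule lipschitz_on_continuous_on)
qed

lemma lip_decay_isCont: "lip_decay k f \<Longrightarrow> isCont f x"
  using lip_decay_continuous continuous_on_eq_continuous_at open_UNIV by blast

lemma lip_decay_measurable [measurable_dest]:
  "lip_decay k f \<Longrightarrow> f \<in> borel_measurable borel"
  by (rule borel_measurable_continuous_onI[OF lip_decay_continuous])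

lemma lip_decay_mult:
  assumes "lip_decay k f" "lip_decay l g"
  shows "lip_decay (k + l) (\<lambda>x. f x * g x)"
proof -
  obtain C where C: "C \<ge> 0" "\<And>x y. cmod (f x - f y) \<le> C * \<bar>x - y\<bar>"
    "\<And>x. cmod (f x) * (1 + \<bar>x\<bar>) ^ k \<le> C" "\<And>x. cmod (f x) \<le> C"
    by (rule lip_decayE[OF assms(1)]) (rule that)
  obtain B where B: "B \<ge> 0" "\<And>x y. cmod (g x - g y) \<le> B * \<bar>x - y\<bar>"
    "\<And>x. cmod (g x) * (1 + \<bar>x\<bar>) ^ l \<le> B" "\<And>x. cmod (g x) \<le> B"
    by (rule lip_decayE[OF assms(2)]) (rule that)
  have "cmod (f x * g x - f y * g y) \<le> (2 * C * B) * \<bar>x - y\<bar>" for x y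
  proof -
    have "f x * g x - f y * g y = f x * (g x - g y) + (f x - f y) * g y"
      by (simp add: algebra_simps)
    also have "cmod \<dots> \<le> C * (B * \<bar>x - y\<bar>) + (C * \<bar>x - y\<bar>) * B"
      by (intro norm_triangle_mono) (auto simp: norm_mult B C intro!: mult_mono)
    finally show ?thesis by (simp add: algebra_simps)
  qed
  moreover have "cmod (f x * g x) * (1 + \<bar>x\<bar>) ^ (k + l) \<le> 2 * C * B" for x
  proof -
    have "(cmod (f x) * (1 + \<bar>x\<bar>) ^ k) * (cmod (g x) * (1 + \<bar>x\<bar>) ^ l) \<le> C * B"
      by (intro mult_mono B C) auto
    moreover have "0 \<le> C * B" using B C by simp
    ultimately show ?thesis by (simp add: norm_mult power_add algebra_simps)
  qed
  ultimately show ?thesis unfolding lip_decay_def by blast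
qed

lemma lip_decay_add:
  assumes "lip_decay k f" "lip_decay k g"
  shows "lip_decay k (\<lambda>x. f x + g x)"
proof -
  obtain C where C: "C \<ge> 0" "\<And>x y. cmod (f x - f y) \<le> C * \<bar>x - y\<bar>"
    "\<And>x. cmod (f x) * (1 + \<bar>x\<bar>) ^ k \<le> C" "\<And>x. cmod (f x) \<le> C"
    by (rule lip_decayE[OF assms(1)]) (rule that)
  obtain B where B: "B \<ge> 0" "\<And>x y. cmod (g x - g y) \<le> B * \<bar>x - y\<bar>"
    "\<And>x. cmod (g x) * (1 + \<bar>x\<bar>) ^ k \<le> B" "\<And>x. cmod (g x) \<le> B"
    by (rule lip_decayE[OF assms(2)]) (rule that)
  have "cmod (f x + g x - (f y + g y)) \<le> (C + B) * \<bar>x - y\<bar>" for x y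
    using norm_triangle_mono[OF C(2)[of x y] B(2)[of x y]] by (simp add: algebra_simps)
  moreover have "cmod (f x + g x) * (1 + \<bar>x\<bar>) ^ k \<le> C + B" for x
  proof -
    have "cmod (f x + g x) * (1 + \<bar>x\<bar>) ^ k \<le> (cmod (f x) + cmod (g x)) * (1 + \<bar>x\<bar>) ^ k"
      by (intro mult_right_mono norm_triangle_ineq) auto
    with C(3)[of x] B(3)[of x] show ?thesis by (simp add: algebra_simps)
  qed
  ultimately show ?thesis unfolding lip_decay_def by blast
qed

lemma lip_decay_cmult:
  assumes "lip_decay k f"
  shows "lip_decay k (\<lambda>x. c * f x)"
proof -
  obtain C where C: "C \<ge> 0" "\<And>x y. cmod (f x - f y) \<le> C * \<bar>x - y\<bar>"
    "\<And>x. cmod (f x) * (1 + \<bar>x\<bar>) ^ k \<le> C" "\<And>x. cmod (f x) \<le> C"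
    by (rule lip_decayE[OF assms(1)]) (rule that)
  have "cmod (c * f x - c * f y) \<le> cmod c * C * \<bar>x - y\<bar>" for x y
    using mult_left_mono[OF C(2)[of x y], of "cmod c"]
    by (simp add: norm_mult mult.assoc flip: right_diff_distrib)
  moreover have "cmod (c * f x) * (1 + \<bar>x\<bar>) ^ k \<le> cmod c * C" for x
    using mult_left_mono[OF C(3)[of x], of "cmod c"] by (simp add: norm_mult mult.assoc)
  ultimately show ?thesis unfolding lip_decay_def by blast
qed

lemma lip_decay_cnj: "lip_decay k f \<Longrightarrow> lip_decay k (\<lambda>x. cnj (f x))"
  unfolding lip_decay_def complex_cnj_diff[symmetric] complex_mod_cnj .

lemma lip_decay_mult_cnj:
  "lip_decay 1 f \<Longrightarrow> lip_decay 1 g \<Longrightarrow> lip_decay 2 (\<lambda>x. f x * cnj (g x))"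
  using lip_decay_mult[OF _ lip_decay_cnj, of 1 f 1 g] by (simp add: numeral_2_eq_2)

section \<open>Majorants of Poisson type\<close>

lemma has_bochner_integral_Poisson:
  "has_bochner_integral lborel (\<lambda>x::real. 1 / (1 + x\<^sup>2)) pi"
  using integrable_inverse_1_plus_square LBINT_inverse_1_plus_square
  by (simp add: has_bochner_integral_iff set_integrable_def interval_lebesgue_integral_def
      set_lebesgue_integral_def inverse_eq_divide)

lemma one_plus_abs_square: "1 + x\<^sup>2 \<le> (1 + \<bar>x\<bar>)\<^sup>2" for x :: real
  by (simp add: power2_eq_square algebra_simps)

text \<open>The inequality \<open>1 + |t| <= (1 + |s + t|) (1 + |s|)\<close> transfers decay in
  \<open>s + t\<close> to decay in \<open>t\<close>, at the price of a factor that stays bounded for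
  bounded \<open>s\<close>.\<close>

lemma lip_decay_2_bound:
  assumes "lip_decay 2 f"
  obtains C where "C \<ge> 0" "\<And>s t. cmod (f (s + t)) \<le> C * (1 + \<bar>s\<bar>)\<^sup>2 / (1 + t\<^sup>2)"
proof -
  obtain C where C: "C \<ge> 0" "\<And>x y. cmod (f x - f y) \<le> C * \<bar>x - y\<bar>"
    "\<And>x. cmod (f x) * (1 + \<bar>x\<bar>) ^ 2 \<le> C" "\<And>x. cmod (f x) \<le> C"
    by (rule lip_decayE[OF assms]) (rule that)
  have "cmod (f (s + t)) \<le> C * (1 + \<bar>s\<bar>)\<^sup>2 / (1 + t\<^sup>2)" for s t
  proof -
    have "(1 + \<bar>t\<bar>) \<le> (1 + \<bar>s + t\<bar>) * (1 + \<bar>s\<bar>)"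
    proof -
      have "\<bar>t\<bar> \<le> \<bar>s + t\<bar> + \<bar>s\<bar>" by linarith
      moreover have "0 \<le> \<bar>s + t\<bar> * \<bar>s\<bar>" by simp
      ultimately show ?thesis unfolding distrib_left distrib_right by linarith
    qed
    then have "(1 + \<bar>t\<bar>)\<^sup>2 \<le> ((1 + \<bar>s + t\<bar>) * (1 + \<bar>s\<bar>))\<^sup>2" by (intro power_mono) auto
    then have "1 + t\<^sup>2 \<le> (1 + \<bar>s + t\<bar>)\<^sup>2 * (1 + \<bar>s\<bar>)\<^sup>2"
      using one_plus_abs_square[of t] unfolding power_mult_distrib by linarith
    then have "cmod (f (s + t)) * (1 + t\<^sup>2) \<le> cmod (f (s + t)) * ((1 + \<bar>s + t\<bar>)\<^sup>2 * (1 + \<bar>s\<bar>)\<^sup>2)"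
      by (intro mult_left_mono) auto
    also have "\<dots> \<le> C * (1 + \<bar>s\<bar>)\<^sup>2"
      using mult_right_mono[OF C(3)[of "s + t"], of "(1 + \<bar>s\<bar>)\<^sup>2"] by (simp add: mult.assoc)
    finally show ?thesis by (simp add: pos_le_divide_eq add_pos_nonneg)
  qed
  with C(1) that show ?thesis by blast
qed

text \<open>For small \<open>t\<close> the Lipschitz bound absorbs the division by \<open>t\<close>;
  for \<open>|t| > 1\<close> the division only helps and decay suffices. The result is the majorant
  for all the limits of principal values below, locally uniform in \<open>s\<close>.\<close>

lemma lip_decay_2_odd_bound:
  assumes "lip_decay 2 f"
  obtains C where "C \<ge> 0"
    "\<And>s t. cmod ((f (s + t) - f (s - t)) / of_real t) \<le> C * (1 + \<bar>s\<bar>)\<^sup>2 * (1 / (1 + t\<^sup>2))"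
proof -
  obtain L where L: "L \<ge> 0" "\<And>x y. cmod (f x - f y) \<le> L * \<bar>x - y\<bar>"
    "\<And>x. cmod (f x) * (1 + \<bar>x\<bar>) ^ 2 \<le> L" "\<And>x. cmod (f x) \<le> L"
    by (rule lip_decayE[OF assms]) (rule that)
  obtain B where B: "B \<ge> 0" "\<And>s t. cmod (f (s + t)) \<le> B * (1 + \<bar>s\<bar>)\<^sup>2 / (1 + t\<^sup>2)"
    by (rule lip_decay_2_bound[OF assms]) (rule that)
  have "cmod ((f (s + t) - f (s - t)) / of_real t) \<le> (4 * L + 2 * B) * (1 + \<bar>s\<bar>)\<^sup>2 * (1 / (1 + t\<^sup>2))" for s t
  proof (cases "\<bar>t\<bar> \<le> 1")
    case True
    then have t2: "t\<^sup>2 \<le> 1" by (simp add: abs_square_le_1)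
    have "cmod ((f (s + t) - f (s - t)) / of_real t) \<le> 2 * L"
      using L(2)[of "s + t" "s - t"] L(1) by (cases "t = 0") (auto simp: norm_divide field_simps)
    \<comment> \<open>The constant doubles because \<open>1 / (1 + t^2)\<close> is at least
      \<open>1/2\<close> on \<open>|t| <= 1\<close>.\<close>
    also have "\<dots> \<le> (4 * L) * 1 * (1 / (1 + t\<^sup>2))"
    proof -
      have "1 / 2 \<le> 1 / (1 + t\<^sup>2)"
        using t2 by (intro divide_left_mono) (auto simp: add_pos_nonneg)
      from mult_left_mono[OF this, of "4 * L"] L(1) show ?thesis by simp
    qed
    also have "\<dots> \<le> (4 * L + 2 * B) * (1 + \<bar>s\<bar>)\<^sup>2 * (1 / (1 + t\<^sup>2))"
      using L B by (intro mult_right_mono mult_mono) auto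
    finally show ?thesis .
  next
    case False
    have "cmod ((f (s + t) - f (s - t)) / of_real t) \<le> cmod (f (s + t) - f (s + (-t)))"
      using False mult_left_mono[of 1 "\<bar>t\<bar>" "cmod (f (s + t) - f (s + (-t)))"]
      by (auto simp: norm_divide divide_le_eq)
    also have "\<dots> \<le> cmod (f (s + t)) + cmod (f (s + (-t)))" by (rule norm_triangle_ineq4)
    also have "\<dots> \<le> 2 * B * (1 + \<bar>s\<bar>)\<^sup>2 * (1 / (1 + t\<^sup>2))"
      using B(2)[of s t] B(2)[of s "-t"] by simp
    also have "\<dots> \<le> (4 * L + 2 * B) * (1 + \<bar>s\<bar>)\<^sup>2 * (1 / (1 + t\<^sup>2))"
      using L B by (intro mult_right_mono) auto
    finally show ?thesis .
  qed
  moreover have "0 \<le> 4 * L + 2 * B" using L B by simp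
  ultimately show ?thesis using that by blast
qed

lemma integrable_Poisson_bound:
  fixes g :: "real \<Rightarrow> complex"
  assumes "g \<in> borel_measurable borel" "\<And>t. cmod (g t) \<le> C * (1 / (1 + t\<^sup>2))"
  shows "integrable lborel g"
proof (rule Bochner_Integration.integrable_bound)
  show "integrable lborel (\<lambda>t::real. C * (1 / (1 + t\<^sup>2)))"
    using has_bochner_integral_Poisson by (simp add: has_bochner_integral_iff del: times_divide_eq_right)
  show "AE t in lborel. cmod (g t) \<le> norm (C * (1 / (1 + t\<^sup>2)))"
    using assms(2) by (intro AE_I2) (smt (verit, best) real_norm_def)
qed (use assms in simp)

text \<open>Dominated convergence with a multiple of \<open>1 / (1 + t^2)\<close> as majorant. The
  point \<open>t = 0\<close>, where the singular kernels sit, is a null set.\<close>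

lemma LIMSEQ_Poisson_bound:
  fixes g :: "nat \<Rightarrow> real \<Rightarrow> complex"
  assumes "\<And>n. g n \<in> borel_measurable borel" "g' \<in> borel_measurable borel"
    and "\<And>n t. cmod (g n t) \<le> C * (1 / (1 + t\<^sup>2))"
    and "\<And>t. t \<noteq> 0 \<Longrightarrow> (\<lambda>n. g n t) \<longlonglongrightarrow> g' t"
  shows "(\<lambda>n. LINT t|lborel. g n t) \<longlonglongrightarrow> (LINT t|lborel. g' t)"
proof (rule integral_dominated_convergence)
  show "integrable lborel (\<lambda>t::real. C * (1 / (1 + t\<^sup>2)))"
    using has_bochner_integral_Poisson by (simp add: has_bochner_integral_iff del: times_divide_eq_right)
  show "AE t in lborel. (\<lambda>n. g n t) \<longlonglongrightarrow> g' t"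
    using AE_lborel_singleton[of 0] by eventually_elim (use assms in auto)
qed (use assms in auto)

lemma lip_decay_2_integrable:
  assumes "lip_decay 2 f" shows "integrable lborel f"
proof -
  obtain C where "C \<ge> 0" "\<And>s t. cmod (f (s + t)) \<le> C * (1 + \<bar>s\<bar>)\<^sup>2 / (1 + t\<^sup>2)"
    by (rule lip_decay_2_bound[OF assms]) (rule that)
  from this(2)[of 0] show ?thesis
    by (intro integrable_Poisson_bound[where C = C] lip_decay_measurable[OF assms]) auto
qed

section \<open>Principal values and boundary values of Cauchy transforms\<close>

text \<open>The average of the two substitutions \<open>x = s + t\<close> and
  \<open>x = s - t\<close>. It pairs the points on both sides of a singularity at \<open>s\<close>,
  so that its odd part cancels.\<close>

lemma lborel_integral_symmetrize:
  fixes g :: "real \<Rightarrow> complex"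
  assumes "integrable lborel g"
  shows "(LINT x|lborel. g x) = (LINT t|lborel. g (s + t) + g (s - t)) / 2"
proof -
  have "integrable lborel (\<lambda>t. g (s + t))" "integrable lborel (\<lambda>t. g (s - t))"
    using lborel_integrable_real_affine[OF assms, of 1 s]
      lborel_integrable_real_affine[OF assms, of "-1" s] by simp_all
  then show ?thesis
    using lborel_integral_real_affine[of 1 g s] lborel_integral_real_affine[of "-1" g s] by simp
qed

text \<open>
  The principal value as an absolutely convergent integral; the integrand is even in \<open>t\<close>,
  which accounts for the factor \<open>1/2\<close>.
\<close>

definition hilb :: "(real \<Rightarrow> complex) \<Rightarrow> real \<Rightarrow> complex" where
  "hilb f s = (LINT t|lborel. (f (s + t) - f (s - t)) / of_real t) / 2"

definition cauchy :: "(real \<Rightarrow> complex) \<Rightarrow> complex \<Rightarrow> complex" where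
  "cauchy f z = (LINT x|lborel. f x / (of_real x - z))"

lemma hilb_integrable:
  assumes "lip_decay 2 f"
  shows "integrable lborel (\<lambda>t. (f (s + t) - f (s - t)) / of_real t)"
proof -
  obtain C where "C \<ge> 0"
    "\<And>s t. cmod ((f (s + t) - f (s - t)) / of_real t) \<le> C * (1 + \<bar>s\<bar>)\<^sup>2 * (1 / (1 + t\<^sup>2))"
    by (rule lip_decay_2_odd_bound[OF assms]) (rule that)
  note [measurable] = lip_decay_measurable[OF assms]
  show ?thesis
    by (rule integrable_Poisson_bound) (measurable, fact)
qed

text \<open>Symmetrization about \<open>s\<close> turns the truncated integral into an integral of
  the difference quotient over \<open>|t| >= \<epsilon>\<close>; the quotient has an integrable
  majorant, so the truncation can be removed.\<close>

lemma pv_gamma_eq_hilb: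
  assumes "lip_decay 2 f"
  shows "pv_gamma f s = hilb f s"
proof -
  obtain C where C: "C \<ge> 0"
    "\<And>s t. cmod ((f (s + t) - f (s - t)) / of_real t) \<le> C * (1 + \<bar>s\<bar>)\<^sup>2 * (1 / (1 + t\<^sup>2))"
    by (rule lip_decay_2_odd_bound[OF assms]) (rule that)
  note [measurable] = lip_decay_measurable[OF assms]
  have eq: "(LINT x:{x. \<bar>x - s\<bar> \<ge> \<epsilon>}|lborel. f x / of_real (x - s)) =
      (LINT t|lborel. indicator {t. \<bar>t\<bar> \<ge> \<epsilon>} t *\<^sub>R ((f (s + t) - f (s - t)) / of_real t)) / 2"
    if "\<epsilon> > 0" for \<epsilon>
  proof -
    let ?g = "\<lambda>x. indicator {x. \<bar>x - s\<bar> \<ge> \<epsilon>} x *\<^sub>R (f x / of_real (x - s))"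
    have "integrable lborel ?g"
    proof (rule Bochner_Integration.integrable_bound)
      show "integrable lborel (\<lambda>x. f x / of_real \<epsilon>)"
        using lip_decay_2_integrable[OF assms] by simp
      have "cmod (?g x) \<le> cmod (f x / of_real \<epsilon>)" for x
        using that by (auto simp: indicator_def norm_divide simp flip: of_real_diff
            intro!: divide_left_mono mult_pos_pos)
      then show "AE x in lborel. cmod (?g x) \<le> cmod (f x / of_real \<epsilon>)" by simp
    qed simp
    from lborel_integral_symmetrize[OF this, of s] show ?thesis
      unfolding set_lebesgue_integral_def
      by (simp add: indicator_def if_distrib diff_divide_distrib scaleR_diff_right cong: if_cong)
  qed
  have "((\<lambda>\<epsilon>. LINT x:{x. \<bar>x - s\<bar> \<ge> \<epsilon>}|lborel. f x / of_real (x - s)) \<longlongrightarrow> hilb f s) (at_right 0)"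
    \<comment> \<open>The limit is tested along sequences of positive radii, to which dominated
      convergence applies.\<close>
    unfolding tendsto_at_iff_sequentially comp_def
  proof (intro allI impI)
    fix X :: "nat \<Rightarrow> real" assume X: "\<forall>i. X i \<in> {0<..} - {0}" "X \<longlonglongrightarrow> 0"
    have "(\<lambda>n. LINT t|lborel. indicator {t. \<bar>t\<bar> \<ge> X n} t *\<^sub>R ((f (s + t) - f (s - t)) / of_real t))
        \<longlonglongrightarrow> (LINT t|lborel. (f (s + t) - f (s - t)) / of_real t)"
    proof (rule LIMSEQ_Poisson_bound)
      fix n t
      show "cmod (indicator {t. \<bar>t\<bar> \<ge> X n} t *\<^sub>R ((f (s + t) - f (s - t)) / of_real t))
          \<le> C * (1 + \<bar>s\<bar>)\<^sup>2 * (1 / (1 + t\<^sup>2))"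
        by (rule order_trans[OF _ C(2)]) (auto simp: indicator_def)
    next
      fix t :: real assume "t \<noteq> 0"
      then have "\<forall>\<^sub>F n in sequentially. X n < \<bar>t\<bar>" using order_tendstoD(2)[OF X(2)] by simp
      then have "\<forall>\<^sub>F n in sequentially. indicator {t. \<bar>t\<bar> \<ge> X n} t *\<^sub>R ((f (s + t) - f (s - t)) / of_real t)
          = (f (s + t) - f (s - t)) / of_real t"
        by eventually_elim (simp add: indicator_def)
      then show "(\<lambda>n. indicator {t. \<bar>t\<bar> \<ge> X n} t *\<^sub>R ((f (s + t) - f (s - t)) / of_real t))
          \<longlonglongrightarrow> (f (s + t) - f (s - t)) / of_real t"
        by (rule tendsto_eventually)
    qed measurable
    then show "(\<lambda>n. LINT x:{x. \<bar>x - s\<bar> \<ge> X n}|lborel. f x / of_real (x - s)) \<longlonglongrightarrow> hilb f s"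
      unfolding hilb_def using X(1) by (subst eq) (auto intro!: tendsto_intros)
  qed
  then show ?thesis unfolding pv_gamma_def by (intro tendsto_Lim) auto
qed

text \<open>The kernel is bounded by \<open>1 / |Im z|\<close> on the real line.\<close>

lemma cauchy_integrable:
  assumes "integrable lborel f" "Im z \<noteq> 0"
  shows "integrable lborel (\<lambda>x. f x / (of_real x - z))"
proof (rule Bochner_Integration.integrable_bound)
  note [measurable] = borel_measurable_integrable[OF assms(1)]
  show "integrable lborel (\<lambda>x. f x / of_real (Im z))" using assms(1) by simp
  have "cmod (f x / (of_real x - z)) \<le> cmod (f x / of_real (Im z))" for x
  proof -
    have "\<bar>Im z\<bar> \<le> cmod (of_real x - z)" using abs_Im_le_cmod[of "of_real x - z"] by simp
    with assms(2) show ?thesis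
      by (auto simp: norm_divide intro!: divide_left_mono mult_pos_pos)
  qed
  then show "AE x in lborel. cmod (f x / (of_real x - z)) \<le> cmod (f x / of_real (Im z))" by simp
  show "(\<lambda>x. f x / (of_real x - z)) \<in> borel_measurable lborel" by measurable
qed

text \<open>The Plemelj formula, with \<sigma> selecting the half-plane. After symmetrization the
  integral splits into the difference quotient damped by \<open>t^2 / (t^2 + \<epsilon>^2)\<close>,
  which tends to the principal value, and a Poisson average of \<open>f\<close>, which tends to its
  value at \<open>s\<close>.\<close>

lemma cauchy_boundary_value:
  assumes f: "lip_decay 2 f" and "\<bar>\<sigma>\<bar> = 1"
  shows "((\<lambda>\<epsilon>. cauchy f (of_real s + of_real \<sigma> * \<i> * of_real \<epsilon>)) \<longlongrightarrow>
      hilb f s + of_real \<sigma> * \<i> * pi * f s) (at_right 0)"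
proof -
  obtain C where C: "C \<ge> 0"
    "\<And>s t. cmod ((f (s + t) - f (s - t)) / of_real t) \<le> C * (1 + \<bar>s\<bar>)\<^sup>2 * (1 / (1 + t\<^sup>2))"
    by (rule lip_decay_2_odd_bound[OF f]) (rule that)
  obtain B where B: "B \<ge> 0" "\<And>x y. cmod (f x - f y) \<le> B * \<bar>x - y\<bar>"
      "\<And>x. cmod (f x) * (1 + \<bar>x\<bar>)\<^sup>2 \<le> B" "\<And>x. cmod (f x) \<le> B"
    by (rule lip_decayE[OF f]) (rule that)
  note [measurable] = lip_decay_measurable[OF f]
  let ?D = "\<lambda>t. (f (s + t) - f (s - t)) / of_real t"
  have \<sigma>: "\<sigma>\<^sup>2 = 1" using assms(2) by (metis one_power2 power2_abs)
  have Re: "cmod (of_real (t\<^sup>2 / (t\<^sup>2 + \<epsilon>\<^sup>2)) * ?D t) \<le> C * (1 + \<bar>s\<bar>)\<^sup>2 * (1 / (1 + t\<^sup>2))"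
    if "\<epsilon> > 0" for \<epsilon> t
  proof -
    have "t\<^sup>2 / (t\<^sup>2 + \<epsilon>\<^sup>2) \<le> 1" "0 \<le> t\<^sup>2 / (t\<^sup>2 + \<epsilon>\<^sup>2)" using that by (auto simp: divide_le_eq_1 add_nonneg_pos)
    then have "cmod (of_real (t\<^sup>2 / (t\<^sup>2 + \<epsilon>\<^sup>2)) * ?D t) \<le> 1 * cmod (?D t)"
      unfolding norm_mult norm_of_real by (intro mult_right_mono) auto
    with C(2)[of s t] show ?thesis by linarith
  qed
  have Im: "cmod ((f (s + \<epsilon> * t) + f (s - \<epsilon> * t)) / of_real (1 + t\<^sup>2)) \<le> (2 * B) * (1 / (1 + t\<^sup>2))"
    for \<epsilon> t
  proof -
    have "cmod (f (s + \<epsilon> * t) + f (s - \<epsilon> * t)) \<le> 2 * B"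
      using norm_triangle_mono[OF B(4)[of "s + \<epsilon> * t"] B(4)[of "s - \<epsilon> * t"]] by simp
    moreover have "cmod (of_real (1 + t\<^sup>2)) = 1 + t\<^sup>2"
      unfolding norm_of_real by (simp add: add_nonneg_nonneg)
    ultimately show ?thesis unfolding norm_divide by (simp add: divide_right_mono add_nonneg_nonneg)
  qed
  have eq: "cauchy f (of_real s + of_real \<sigma> * \<i> * of_real \<epsilon>) =
      (LINT t|lborel. of_real (t\<^sup>2 / (t\<^sup>2 + \<epsilon>\<^sup>2)) * ?D t) / 2 +
      of_real \<sigma> * \<i> * (LINT t|lborel. (f (s + \<epsilon> * t) + f (s - \<epsilon> * t)) / of_real (1 + t\<^sup>2)) / 2"
    if \<epsilon>: "\<epsilon> > 0" for \<epsilon>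
  proof -
    let ?z = "of_real s + of_real \<sigma> * \<i> * of_real \<epsilon>"
    \<comment> \<open>The Poisson part. The substitution \<open>t -> \<epsilon> t\<close> makes its
      kernel \<open>1 / (1 + t^2)\<close> and moves \<epsilon> into the arguments of
      \<open>f\<close>, where continuity can be used.\<close>
    define S where "S t = \<epsilon> *\<^sub>R ((f (s + t) + f (s - t)) / of_real (t\<^sup>2 + \<epsilon>\<^sup>2))" for t
    have S_scale: "\<epsilon> *\<^sub>R S (0 + \<epsilon> * t) = (f (s + \<epsilon> * t) + f (s - \<epsilon> * t)) / of_real (1 + t\<^sup>2)" for t
    proof -
      have "of_real ((\<epsilon> * t)\<^sup>2 + \<epsilon>\<^sup>2) = of_real (\<epsilon> * \<epsilon>) * complex_of_real (1 + t\<^sup>2)"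
        by (simp add: power2_eq_square algebra_simps)
      then show ?thesis using \<epsilon> by (simp add: S_def scaleR_conv_of_real)
    qed
    have "integrable lborel (\<lambda>t. \<epsilon> *\<^sub>R S (0 + \<epsilon> * t))"
      unfolding S_scale by (rule integrable_Poisson_bound[OF _ Im]) measurable
    from integrable_scaleR_right[OF this, of "inverse \<epsilon>"]
    have "integrable lborel (\<lambda>t. S (0 + \<epsilon> * t))" using \<epsilon> by simp
    then have intS: "integrable lborel S"
      using lborel_integrable_real_affine_iff[of \<epsilon> S 0] \<epsilon> by simp
    have "integral\<^sup>L lborel S = \<epsilon> *\<^sub>R (LINT t|lborel. S (0 + \<epsilon> * t))"
      using lborel_integral_real_affine[of \<epsilon> S 0] \<epsilon> by simp
    also have "\<dots> = (LINT t|lborel. (f (s + \<epsilon> * t) + f (s - \<epsilon> * t)) / of_real (1 + t\<^sup>2))"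
      unfolding S_scale[symmetric] by simp
    finally have Seq: "integral\<^sup>L lborel S = \<dots>" .
    have intD: "integrable lborel (\<lambda>t. of_real (t\<^sup>2 / (t\<^sup>2 + \<epsilon>\<^sup>2)) * ?D t)"
      by (rule integrable_Poisson_bound[OF _ Re[OF \<epsilon>]]) measurable
    have "Im ?z \<noteq> 0" using \<epsilon> assms(2) by auto
    from lborel_integral_symmetrize[OF cauchy_integrable[OF lip_decay_2_integrable[OF f] this], of s]
    have "cauchy f ?z = (LINT t|lborel. f (s + t) / (of_real (s + t) - ?z)
          + f (s - t) / (of_real (s - t) - ?z)) / 2"
      unfolding cauchy_def .
    also have "(\<lambda>t. f (s + t) / (of_real (s + t) - ?z) + f (s - t) / (of_real (s - t) - ?z))
      = (\<lambda>t. of_real (t\<^sup>2 / (t\<^sup>2 + \<epsilon>\<^sup>2)) * ?D t + of_real \<sigma> * \<i> * S t)"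
    proof
      fix t :: real
      let ?w = "complex_of_real t + of_real \<sigma> * \<i> * of_real \<epsilon>"
      let ?v = "complex_of_real t - of_real \<sigma> * \<i> * of_real \<epsilon>"
      \<comment> \<open>The two shifted denominators are complex conjugates; \<sigma> drops out of
        their product because its square is 1.\<close>
      have vw: "?v * ?w = of_real (t\<^sup>2 + \<epsilon>\<^sup>2)"
      proof -
        have "?v * ?w = (of_real t)\<^sup>2 + of_real (\<sigma>\<^sup>2) * (of_real \<epsilon>)\<^sup>2"
          by (simp add: power2_eq_square algebra_simps)
        then show ?thesis by (simp add: \<sigma>)
      qed
      have nz: "?v \<noteq> 0" "?w \<noteq> 0" "complex_of_real (t\<^sup>2 + \<epsilon>\<^sup>2) \<noteq> 0"
        using \<epsilon> assms(2) by (auto simp: complex_eq_iff add_nonneg_eq_0_iff simp del: of_real_add of_real_power)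
      have 1: "1 / ?v = ?w / of_real (t\<^sup>2 + \<epsilon>\<^sup>2)" and 2: "1 / ?w = ?v / of_real (t\<^sup>2 + \<epsilon>\<^sup>2)"
        using nz unfolding vw[symmetric] by (simp_all add: field_simps)
      have "f (s + t) / (of_real (s + t) - ?z) + f (s - t) / (of_real (s - t) - ?z)
          = f (s + t) * (1 / ?v) - f (s - t) * (1 / ?w)"
      proof -
        have "of_real (s + t) - ?z = ?v" "of_real (s - t) - ?z = - ?w" by simp_all
        then show ?thesis by (simp only: divide_minus_right) (simp add: divide_inverse)
      qed
      also have "\<dots> = (of_real t * (f (s + t) - f (s - t)) + of_real \<sigma> * \<i> * of_real \<epsilon> * (f (s + t) + f (s - t)))
          / of_real (t\<^sup>2 + \<epsilon>\<^sup>2)"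
        unfolding 1 2 by (simp add: field_simps diff_divide_distrib add_divide_distrib)
      \<comment> \<open>At \<open>t = 0\<close> the first summand vanishes on both sides, the
        quotient \<open>?D 0\<close> being 0 by the convention for division by zero.\<close>
      also have "\<dots> = of_real (t\<^sup>2 / (t\<^sup>2 + \<epsilon>\<^sup>2)) * ?D t + of_real \<sigma> * \<i> * S t"
        by (cases "t = 0") (simp_all add: S_def add_divide_distrib distrib_left mult.assoc scaleR_conv_of_real power2_eq_square)
      finally show "f (s + t) / (of_real (s + t) - ?z) + f (s - t) / (of_real (s - t) - ?z)
          = of_real (t\<^sup>2 / (t\<^sup>2 + \<epsilon>\<^sup>2)) * ?D t + of_real \<sigma> * \<i> * S t" .
    qed
    also have "(LINT t|lborel. of_real (t\<^sup>2 / (t\<^sup>2 + \<epsilon>\<^sup>2)) * ?D t + of_real \<sigma> * \<i> * S t)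
        = (LINT t|lborel. of_real (t\<^sup>2 / (t\<^sup>2 + \<epsilon>\<^sup>2)) * ?D t) + of_real \<sigma> * \<i> * integral\<^sup>L lborel S"
      by (subst Bochner_Integration.integral_add[OF intD integrable_mult_right[OF intS]])
        (subst integral_mult_right_zero, rule refl)
    finally show ?thesis unfolding Seq by (simp add: add_divide_distrib)
  qed
  show ?thesis
    unfolding tendsto_at_iff_sequentially comp_def
  proof (intro allI impI)
    fix X :: "nat \<Rightarrow> real" assume X: "\<forall>i. X i \<in> {0<..} - {0}" "X \<longlonglongrightarrow> 0"
    then have pos: "X n > 0" for n by auto
    have "(\<lambda>n. LINT t|lborel. of_real (t\<^sup>2 / (t\<^sup>2 + (X n)\<^sup>2)) * ?D t) \<longlonglongrightarrow> (LINT t|lborel. ?D t)"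
    proof (rule LIMSEQ_Poisson_bound[OF _ _ Re[OF pos]])
      fix t :: real assume t: "t \<noteq> 0"
      have "(\<lambda>n. of_real (t\<^sup>2 / (t\<^sup>2 + (X n)\<^sup>2)) * ?D t) \<longlonglongrightarrow> of_real (t\<^sup>2 / (t\<^sup>2 + 0\<^sup>2)) * ?D t"
        using t by (intro tendsto_intros X) auto
      then show "(\<lambda>n. of_real (t\<^sup>2 / (t\<^sup>2 + (X n)\<^sup>2)) * ?D t) \<longlonglongrightarrow> ?D t" using t by simp
    qed measurable
    then have 1: "(\<lambda>n. (LINT t|lborel. of_real (t\<^sup>2 / (t\<^sup>2 + (X n)\<^sup>2)) * ?D t) / 2) \<longlonglongrightarrow> hilb f s"
      unfolding hilb_def by (intro tendsto_intros) auto
    have "(\<lambda>n. LINT t|lborel. (f (s + X n * t) + f (s - X n * t)) / of_real (1 + t\<^sup>2))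
        \<longlonglongrightarrow> (LINT t|lborel. (f s + f s) / of_real (1 + t\<^sup>2))"
    proof (rule LIMSEQ_Poisson_bound[OF _ _ Im])
      fix t :: real
      have "(\<lambda>n. s + X n * t) \<longlonglongrightarrow> s + 0 * t" "(\<lambda>n. s - X n * t) \<longlonglongrightarrow> s - 0 * t"
        by (intro tendsto_intros X)+
      then have "(\<lambda>n. f (s + X n * t)) \<longlonglongrightarrow> f s" "(\<lambda>n. f (s - X n * t)) \<longlonglongrightarrow> f s"
        by (simp_all add: isCont_tendsto_compose[OF lip_decay_isCont[OF f]])
      moreover have "complex_of_real (1 + t\<^sup>2) \<noteq> 0"
        unfolding of_real_eq_0_iff by (simp add: add_nonneg_eq_0_iff)
      ultimately show "(\<lambda>n. (f (s + X n * t) + f (s - X n * t)) / of_real (1 + t\<^sup>2))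
          \<longlonglongrightarrow> (f s + f s) / of_real (1 + t\<^sup>2)"
        by (intro tendsto_intros)
    qed measurable
    \<comment> \<open>The Poisson kernel has total mass \<pi>; the factor 2 in
      \<open>f s + f s\<close> cancels the halving from the symmetrization.\<close>
    moreover have "(LINT t|lborel. (f s + f s) / of_real (1 + t\<^sup>2)) = (f s + f s) * of_real pi"
      using has_bochner_integral_mult_right[OF has_bochner_integral_of_real[OF has_bochner_integral_Poisson],
          of "f s + f s"]
      by (simp add: has_bochner_integral_iff)
    ultimately have 2: "(\<lambda>n. of_real \<sigma> * \<i> * (LINT t|lborel. (f (s + X n * t) + f (s - X n * t)) / of_real (1 + t\<^sup>2)) / 2)
        \<longlonglongrightarrow> of_real \<sigma> * \<i> * ((f s + f s) * of_real pi) / 2"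
      by (intro tendsto_intros) auto
    from tendsto_add[OF 1 2]
    show "(\<lambda>n. cauchy f (of_real s + of_real \<sigma> * \<i> * of_real (X n))) \<longlonglongrightarrow>
        hilb f s + of_real \<sigma> * \<i> * pi * f s"
      unfolding eq[OF pos] by (simp add: algebra_simps)
  qed
qed

section \<open>Smoothness of the principal value in its base point\<close>

text \<open>A convergent sequence of base points is bounded, hence the factors
  \<open>(1 + |X n|)^2\<close> are bounded and one majorant serves the whole sequence.\<close>

lemma isCont_hilb:
  assumes f: "lip_decay 2 f"
  shows "isCont (hilb f) s"
  unfolding continuous_at_sequentially comp_def
proof (intro allI impI)
  fix X assume X: "X \<longlonglongrightarrow> s"
  obtain C where C: "C \<ge> 0"
    "\<And>s t. cmod ((f (s + t) - f (s - t)) / of_real t) \<le> C * (1 + \<bar>s\<bar>)\<^sup>2 * (1 / (1 + t\<^sup>2))"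
    by (rule lip_decay_2_odd_bound[OF f]) (rule that)
  note [measurable] = lip_decay_measurable[OF f]
  obtain R where R: "\<And>n. \<bar>X n\<bar> \<le> R"
    using Bseq_def convergentI[OF X] convergent_imp_Bseq real_norm_def by metis
  have "(\<lambda>n. LINT t|lborel. (f (X n + t) - f (X n - t)) / of_real t)
      \<longlonglongrightarrow> (LINT t|lborel. (f (s + t) - f (s - t)) / of_real t)"
  proof (rule LIMSEQ_Poisson_bound)
    fix n t
    show "cmod ((f (X n + t) - f (X n - t)) / of_real t) \<le> C * (1 + R)\<^sup>2 * (1 / (1 + t\<^sup>2))"
      using C(1) R[of n]
      by (intro order_trans[OF C(2)] mult_right_mono mult_left_mono power_mono) auto
  next
    fix t :: real assume "t \<noteq> 0"
    then show "(\<lambda>n. (f (X n + t) - f (X n - t)) / of_real t) \<longlonglongrightarrow> (f (s + t) - f (s - t)) / of_real t"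
      by (intro tendsto_intros isCont_tendsto_compose[OF lip_decay_isCont[OF f]] X) auto
  qed measurable
  then show "(\<lambda>n. hilb f (X n)) \<longlonglongrightarrow> hilb f s"
    unfolding hilb_def by (intro tendsto_intros) auto
qed

text \<open>Differentiation under the integral sign. The mean value inequality bounds the increment
  of the integrand by the majorant of its derivative; the linear term obeys the same bound, whence
  the factor 2 for the remainder quotient.\<close>

lemma hilb_has_vector_derivative:
  assumes f: "lip_decay 2 f" and f': "lip_decay 2 f'"
    and deriv: "\<And>x. (f has_vector_derivative f' x) (at x)"
  shows "(hilb f has_vector_derivative hilb f' s) (at s)"
  unfolding has_vector_derivative_def has_derivative_at_within
proof (intro conjI bounded_linear_scaleR_left)
  define g where "g t y = (f (y + t) - f (y - t)) / of_real t" for t y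
  define g' where "g' t y = (f' (y + t) - f' (y - t)) / of_real t" for t y
  obtain C where C: "C \<ge> 0" "\<And>y t. cmod (g' t y) \<le> C * (1 + \<bar>y\<bar>)\<^sup>2 * (1 / (1 + t\<^sup>2))"
    by (rule lip_decay_2_odd_bound[OF f', unfolded g'_def[symmetric]]) (rule that)
  note [measurable] = lip_decay_measurable[OF f] lip_decay_measurable[OF f']
  have g: "(g t has_vector_derivative g' t y) (at y)" for t y
  proof -
    have "((\<lambda>y. y + c) has_vector_derivative 1) (at y)" for c
      unfolding has_real_derivative_iff_has_vector_derivative[symmetric]
      by (auto intro!: derivative_eq_intros)
    then have "((\<lambda>y. f (y + c)) has_vector_derivative f' (y + c)) (at y)" for c
      using vector_diff_chain_at[of "\<lambda>y. y + c" 1 y f] deriv[of "y + c"] by (simp add: o_def)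
    from this[of t] this[of "-t"]
    have "((\<lambda>y. f (y + t)) has_vector_derivative f' (y + t)) (at y)"
      "((\<lambda>y. f (y - t)) has_vector_derivative f' (y - t)) (at y)"
      by simp_all
    from has_vector_derivative_diff[OF this] show ?thesis
      unfolding g_def[abs_def] g'_def by (rule has_vector_derivative_divide)
  qed
  show "((\<lambda>y. (hilb f y - hilb f s - (y - s) *\<^sub>R hilb f' s) /\<^sub>R norm (y - s)) \<longlongrightarrow> 0) (at s)"
    unfolding tendsto_at_iff_sequentially comp_def
  proof (intro allI impI)
    fix X assume X: "\<forall>i. X i \<in> UNIV - {s}" "X \<longlonglongrightarrow> s"
    obtain R' where R': "\<And>n. \<bar>X n\<bar> \<le> R'"
      using Bseq_def convergentI[OF X(2)] convergent_imp_Bseq real_norm_def by metis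
    \<comment> \<open>The interval from \<open>-R\<close> to \<open>R\<close> contains the limit
      point as well as the sequence, so the mean value inequality can be used on it.\<close>
    define R where "R = max R' \<bar>s\<bar>"
    have R: "X n \<in> {-R..R}" "s \<in> {-R..R}" for n using R'[of n] by (auto simp: R_def)
    \<comment> \<open>The Frechet remainder quotient of the integrand at fixed \<open>t\<close>;
      half its integral is the remainder quotient of \<open>hilb f\<close>.\<close>
    define q where "q n t = (g t (X n) - g t s - (X n - s) *\<^sub>R g' t s) /\<^sub>R norm (X n - s)" for n t
    have bd: "cmod (g' t y) \<le> C * (1 + R)\<^sup>2 * (1 / (1 + t\<^sup>2))" if "y \<in> {-R..R}" for t y
      using C(1) that
      by (intro order_trans[OF C(2)] mult_right_mono mult_left_mono power_mono) auto
    have lim: "(\<lambda>n. LINT t|lborel. q n t) \<longlonglongrightarrow> (LINT t::real|lborel. 0)"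
    proof (rule LIMSEQ_Poisson_bound)
      fix n t
      have "cmod (g t (X n) - g t s) \<le> C * (1 + R)\<^sup>2 * (1 / (1 + t\<^sup>2)) * norm (X n - s)"
      proof (rule differentiable_bound[where S = "{-R..R}" and f' = "\<lambda>y h. h *\<^sub>R g' t y"])
        show "(g t has_derivative (\<lambda>h. h *\<^sub>R g' t y)) (at y within {-R..R})" for y
          using g[of t y] unfolding has_vector_derivative_def by (rule has_derivative_at_withinI)
        show "onorm (\<lambda>h. h *\<^sub>R g' t y) \<le> C * (1 + R)\<^sup>2 * (1 / (1 + t\<^sup>2))" if "y \<in> {-R..R}" for y
          using bd[OF that] by (simp add: onorm_scaleR_left[OF bounded_linear_ident] onorm_id)
      qed (use R in auto)
      moreover have "cmod ((X n - s) *\<^sub>R g' t s) \<le> C * (1 + R)\<^sup>2 * (1 / (1 + t\<^sup>2)) * norm (X n - s)"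
        using mult_left_mono[OF bd[OF R(2)], of "norm (X n - s)"] by (simp add: mult.commute)
      ultimately have "cmod (g t (X n) - g t s - (X n - s) *\<^sub>R g' t s)
          \<le> C * (1 + R)\<^sup>2 * (1 / (1 + t\<^sup>2)) * norm (X n - s) + C * (1 + R)\<^sup>2 * (1 / (1 + t\<^sup>2)) * norm (X n - s)"
        using norm_triangle_ineq4[of "g t (X n) - g t s" "(X n - s) *\<^sub>R g' t s"] by linarith
      moreover have "norm (X n - s) > 0" using X(1) by auto
      moreover have "cmod (q n t) = cmod (g t (X n) - g t s - (X n - s) *\<^sub>R g' t s) / norm (X n - s)"
        unfolding q_def norm_scaleR by (simp add: divide_inverse mult.commute)
      ultimately show "cmod (q n t) \<le> 2 * (C * (1 + R)\<^sup>2) * (1 / (1 + t\<^sup>2))"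
        by (simp only: pos_divide_le_eq)
    next
      fix t :: real
      show "(\<lambda>n. q n t) \<longlonglongrightarrow> 0"
        using g[of t s] X
        unfolding has_vector_derivative_def has_derivative_at_within tendsto_at_iff_sequentially q_def comp_def
        by blast
    qed (unfold q_def g_def g'_def, measurable)
    have eq: "(LINT t|lborel. q n t) / 2 =
        (hilb f (X n) - hilb f s - (X n - s) *\<^sub>R hilb f' s) /\<^sub>R norm (X n - s)" for n
    proof -
      have int: "integrable lborel (\<lambda>t. g t y)" "integrable lborel (\<lambda>t. g' t y)" for y
        unfolding g_def g'_def by (intro hilb_integrable f f')+
      have hilb: "hilb f y = (LINT t|lborel. g t y) / 2" "hilb f' y = (LINT t|lborel. g' t y) / 2" for y
        unfolding hilb_def g_def g'_def by simp_all
      have q: "(LINT t|lborel. q n t) = ((LINT t|lborel. g t (X n)) - (LINT t|lborel. g t s)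
          - (X n - s) *\<^sub>R (LINT t|lborel. g' t s)) /\<^sub>R norm (X n - s)"
        unfolding q_def using int by simp
      show ?thesis
        unfolding hilb q by (simp add: scaleR_conv_of_real right_diff_distrib diff_divide_distrib)
    qed
    show "(\<lambda>n. (hilb f (X n) - hilb f s - (X n - s) *\<^sub>R hilb f' s) /\<^sub>R norm (X n - s)) \<longlonglongrightarrow> 0"
      unfolding eq[symmetric] using lim by (intro tendsto_divide_zero) simp
  qed
qed

section \<open>Increments between two moving points\<close>

text \<open>Both endpoints move, and \<open>k\<close> may be much smaller than the distance from
  \<open>a\<close> to \<open>m\<close>, so differentiability at \<open>m\<close> alone would not do.
  Continuity of \<open>G'\<close> at \<open>m\<close> makes \<open>G\<close> nearly affine on a
  whole ball around \<open>m\<close>.\<close>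

lemma C1_increment_tendsto:
  fixes G :: "real \<Rightarrow> complex" and k :: "'a \<Rightarrow> real"
  assumes deriv: "\<And>x. (G has_vector_derivative G' x) (at x)" and cont: "isCont G' m"
    and a: "(a \<longlongrightarrow> m) F" and k: "(k \<longlongrightarrow> 0) F" "\<forall>\<^sub>F x in F. k x \<noteq> 0"
  shows "((\<lambda>x. (G (a x + h * k x) - G (a x)) / of_real (k x)) \<longlongrightarrow> of_real h * G' m) F"
proof (rule tendstoI)
  fix e :: real assume e: "e > 0"
  \<comment> \<open>The summand 1 covers \<open>h = 0\<close> and makes \<open>|h| e' < e\<close>
    strict.\<close>
  define e' where "e' = e / (\<bar>h\<bar> + 1)"
  have e': "e' > 0" "\<bar>h\<bar> * e' < e" using e by (auto simp: e'_def field_simps)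
  obtain d where d: "d > 0" "\<And>x. dist x m < d \<Longrightarrow> dist (G' x) (G' m) < e'"
    using cont e'(1) unfolding continuous_at_eps_delta by (auto simp: dist_norm)
  have b: "((\<lambda>x. a x + h * k x) \<longlongrightarrow> m + h * 0) F" by (intro tendsto_intros a k)
  have "\<forall>\<^sub>F x in F. a x \<in> ball m d" "\<forall>\<^sub>F x in F. a x + h * k x \<in> ball m d"
    using tendstoD[OF a d(1)] tendstoD[OF b d(1)] by (simp_all add: dist_commute)
  with k(2) show "\<forall>\<^sub>F x in F. dist ((G (a x + h * k x) - G (a x)) / of_real (k x)) (of_real h * G' m) < e"
  proof eventually_elim
    case (elim x)
    have seg: "a x + t *\<^sub>R (a x + h * k x - a x) \<in> ball m d" if "t \<in> {0..1}" for t
      using convexD_alt[OF convex_ball elim(2,3), of t] that by (simp add: algebra_simps)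
    have "cmod (G (a x + h * k x) - G (a x) - (a x + h * k x - a x) *\<^sub>R G' m) \<le> norm (a x + h * k x - a x) * e'"
    proof (rule differentiable_bound_linearization[where S = "ball m d" and f' = "\<lambda>y h. h *\<^sub>R G' y"])
      show "(G has_derivative (\<lambda>h. h *\<^sub>R G' y)) (at y within ball m d)" for y
        using deriv[of y] unfolding has_vector_derivative_def by (rule has_derivative_at_withinI)
      show "onorm ((\<lambda>h. h *\<^sub>R G' y) - (\<lambda>h. h *\<^sub>R G' m)) \<le> e'" if "y \<in> ball m d" for y
      proof -
        have "dist y m < d" using that by (simp add: dist_commute)
        from d(2)[OF this] show ?thesis
          unfolding fun_diff_def scaleR_diff_right[symmetric]
          by (simp add: onorm_scaleR_left[OF bounded_linear_ident] onorm_id dist_norm)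
      qed
    qed (use d seg in auto)
    then have "cmod (G (a x + h * k x) - G (a x) - of_real (h * k x) * G' m) \<le> \<bar>h\<bar> * e' * \<bar>k x\<bar>"
      by (simp add: scaleR_conv_of_real abs_mult mult_ac)
    moreover have "(G (a x + h * k x) - G (a x)) / of_real (k x) - of_real h * G' m =
        (G (a x + h * k x) - G (a x) - of_real (h * k x) * G' m) / of_real (k x)"
      using elim(1) by (simp add: field_simps)
    ultimately have "dist ((G (a x + h * k x) - G (a x)) / of_real (k x)) (of_real h * G' m) \<le> \<bar>h\<bar> * e'"
      using elim(1) by (simp add: dist_norm norm_divide pos_divide_le_eq)
    with e'(2) show ?case by linarith
  qed
qed

section \<open>Schwartz functions and the eigenfunction\<close>

lemma schwartz_bounded_mult:
  assumes "f \<in> schwartz"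
  shows "bounded (range (\<lambda>x. x ^ m *\<^sub>R f x))"
proof -
  have "bounded (range (\<lambda>x. x ^ m *\<^sub>R iter_deriv 0 f x))"
    using assms unfolding schwartz_def by blast
  then show ?thesis by (simp add: iter_deriv_def)
qed

lemma schwartz_has_vector_derivative:
  assumes "f \<in> schwartz"
  shows "(f has_vector_derivative vector_derivative f (at x)) (at x)"
proof -
  have "iter_deriv 0 f differentiable (at x)" using assms unfolding schwartz_def by blast
  then show ?thesis by (simp add: iter_deriv_def vector_derivative_works[symmetric])
qed

lemma schwartz_vector_derivative:
  assumes "f \<in> schwartz"
  shows "(\<lambda>x. vector_derivative f (at x)) \<in> schwartz"
proof -
  have "iter_deriv n (\<lambda>x. vector_derivative f (at x)) = iter_deriv (Suc n) f" for n
    unfolding iter_deriv_def funpow_Suc_right by simp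
  then show ?thesis using assms unfolding schwartz_def by simp
qed

text \<open>A bounded derivative gives the Lipschitz estimate, and boundedness of \<open>f x\<close>
  and \<open>x f x\<close> gives the weighted one. The sum of the three bounds is a common
  constant.\<close>

lemma schwartz_lip_decay:
  assumes "f \<in> schwartz"
  shows "lip_decay 1 f"
proof -
  obtain A where A: "\<And>x. cmod (f x) \<le> A"
    using schwartz_bounded_mult[OF assms, of 0] by (auto simp: bounded_iff)
  obtain B where B: "\<And>x. cmod (x *\<^sub>R f x) \<le> B"
    using schwartz_bounded_mult[OF assms, of 1] by (auto simp: bounded_iff)
  obtain L where L: "\<And>x. cmod (vector_derivative f (at x)) \<le> L"
    using schwartz_bounded_mult[OF schwartz_vector_derivative[OF assms], of 0] by (auto simp: bounded_iff)
  have nn: "0 \<le> A" "0 \<le> B" "0 \<le> L"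
    using order_trans[OF norm_ge_zero A] order_trans[OF norm_ge_zero B] order_trans[OF norm_ge_zero L]
    by blast+
  have "cmod (f x - f y) \<le> (A + B + L) * \<bar>x - y\<bar>" for x y
  proof -
    have "cmod (f x - f y) \<le> L * norm (x - y)"
    proof (rule differentiable_bound[where S = UNIV and f' = "\<lambda>y h. h *\<^sub>R vector_derivative f (at y)"])
      show "(f has_derivative (\<lambda>h. h *\<^sub>R vector_derivative f (at y))) (at y)" for y
        using schwartz_has_vector_derivative[OF assms] unfolding has_vector_derivative_def .
      show "onorm (\<lambda>h. h *\<^sub>R vector_derivative f (at y)) \<le> L" for y
        using L by (simp add: onorm_scaleR_left[OF bounded_linear_ident] onorm_id)
    qed auto
    also have "\<dots> \<le> (A + B + L) * \<bar>x - y\<bar>" using nn by (simp add: mult_right_mono)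
    finally show ?thesis .
  qed
  moreover have "cmod (f x) * (1 + \<bar>x\<bar>) ^ 1 \<le> A + B + L" for x
    using A[of x] B[of x] nn by (simp add: algebra_simps)
  ultimately show ?thesis unfolding lip_decay_def by blast
qed

lemma phi_mult: "u m = 0 \<Longrightarrow> of_real (x - m) * phi u m x = u x"
  by (simp add: phi_def)

text \<open>The quotient is the average of \<open>u'\<close> over the segment from \<open>m\<close>
  to \<open>x\<close>, also for \<open>x = m\<close>. It therefore inherits the Lipschitz constant
  of \<open>u'\<close>; its decay comes from \<open>(x - m) phi = u\<close>.\<close>

lemma phi_lip_decay:
  assumes u: "lip_decay 1 u" and u': "lip_decay 1 u'"
    and deriv: "\<And>x. (u has_vector_derivative u' x) (at x)" and "u m = 0"
  shows "lip_decay 1 (phi u m)"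
proof -
  obtain A where A: "A \<ge> 0" "\<And>x y. cmod (u x - u y) \<le> A * \<bar>x - y\<bar>"
    "\<And>x. cmod (u x) * (1 + \<bar>x\<bar>) ^ 1 \<le> A" "\<And>x. cmod (u x) \<le> A"
    by (rule lip_decayE[OF u]) (rule that)
  obtain L where L: "L \<ge> 0" "\<And>x y. cmod (u' x - u' y) \<le> L * \<bar>x - y\<bar>"
    "\<And>x. cmod (u' x) * (1 + \<bar>x\<bar>) ^ 1 \<le> L" "\<And>x. cmod (u' x) \<le> L"
    by (rule lip_decayE[OF u']) (rule that)
  have int: "((\<lambda>s. u' (m + s * (x - m))) has_integral phi u m x) {0..1}" for x
  proof (cases "x = m")
    case True
    have "phi u m m = u' m"
      unfolding phi_def using vector_derivative_at[OF deriv] by simp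
    then show ?thesis using True has_integral_const_real[of "u' m" 0 1] by simp
  next
    case False
    have "((\<lambda>s. u (m + s * (x - m))) has_vector_derivative (x - m) *\<^sub>R u' (m + s * (x - m))) (at s within {0..1})" for s
    proof -
      have "((\<lambda>s. m + s * (x - m)) has_vector_derivative (x - m)) (at s)"
        unfolding has_real_derivative_iff_has_vector_derivative[symmetric]
        by (auto intro!: derivative_eq_intros)
      from vector_diff_chain_at[OF this deriv] show ?thesis
        by (simp add: o_def has_vector_derivative_at_within)
    qed
    from fundamental_theorem_of_calculus[OF _ this]
    have "((\<lambda>s. (x - m) *\<^sub>R u' (m + s * (x - m))) has_integral u x) {0..1}"
      using assms(4) by simp
    moreover have "inverse (x - m) *\<^sub>R u x = phi u m x"
      using False by (simp add: phi_def scaleR_conv_of_real divide_inverse mult.commute)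
    ultimately show ?thesis
      using has_integral_cmul[of "\<lambda>s. (x - m) *\<^sub>R u' (m + s * (x - m))" "u x" "{0..1}" "inverse (x - m)"]
        False by (simp del: of_real_diff)
  qed
  have lip: "cmod (phi u m x - phi u m y) \<le> L * \<bar>x - y\<bar>" for x y
  proof -
    have "cmod (u' (m + s * (x - m)) - u' (m + s * (y - m))) \<le> L * \<bar>x - y\<bar>" if "s \<in> {0..1}" for s
    proof -
      have "\<bar>m + s * (x - m) - (m + s * (y - m))\<bar> = \<bar>s\<bar> * \<bar>x - y\<bar>"
        unfolding abs_mult[symmetric] by (simp add: algebra_simps)
      also have "\<dots> \<le> 1 * \<bar>x - y\<bar>" using that by (intro mult_right_mono) auto
      finally have "L * \<bar>m + s * (x - m) - (m + s * (y - m))\<bar> \<le> L * \<bar>x - y\<bar>"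
        using L(1) by (simp add: mult_left_mono)
      with L(2)[of "m + s * (x - m)" "m + s * (y - m)"] show ?thesis by linarith
    qed
    with has_integral_bound_real[OF _ finite.emptyI has_integral_diff[OF int int], of "L * \<bar>x - y\<bar>" x y]
    show ?thesis using L(1) by simp
  qed
  have bd: "cmod (phi u m x) \<le> L" for x
    using has_integral_bound_real[OF L(1) finite.emptyI int] L(4) by simp
  \<comment> \<open>The weight is at most \<open>(1 + |m|) + |x - m|\<close>: the first summand
    meets the bound on \<open>phi\<close>, the second turns \<open>phi\<close> back into
    \<open>u\<close>.\<close>
  have "cmod (phi u m x) * (1 + \<bar>x\<bar>) \<le> L * (1 + \<bar>m\<bar>) + A" for x
  proof -
    have "cmod (phi u m x) * (1 + \<bar>x\<bar>) \<le> cmod (phi u m x) * ((1 + \<bar>m\<bar>) + \<bar>x - m\<bar>)"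
      by (intro mult_left_mono) auto
    also have "\<dots> = cmod (phi u m x) * (1 + \<bar>m\<bar>) + cmod (u x)"
      unfolding arg_cong[OF phi_mult[of u m x], of cmod, OF assms(4), symmetric] norm_mult norm_of_real
      by (simp add: algebra_simps)
    also have "\<dots> \<le> L * (1 + \<bar>m\<bar>) + A"
      by (intro add_mono mult_right_mono bd A) auto
    finally show ?thesis .
  qed
  moreover have "L \<le> L * (1 + \<bar>m\<bar>) + A" using L A by (simp add: algebra_simps)
  then have "cmod (phi u m x - phi u m y) \<le> (L * (1 + \<bar>m\<bar>) + A) * \<bar>x - y\<bar>" for x y
    by (intro order_trans[OF lip] mult_right_mono) auto
  ultimately show ?thesis unfolding lip_decay_def power_one_right by blast
qed

section \<open>Principal values at a zero\<close>

text \<open>The factor \<open>x - m\<close> cancels the singularity: the difference quotient of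
  \<open>f\<close> becomes \<open>g (m + t) + g (m - t)\<close>. In this way principal values at
  \<open>\<mu>\<^sub>0\<close> turn into inner products with \<open>phi\<close>.\<close>

lemma hilb_removable:
  assumes "\<And>x. f x = of_real (x - m) * g x" "integrable lborel g"
  shows "hilb f m = integral\<^sup>L lborel g"
proof -
  note [measurable] = borel_measurable_integrable[OF assms(2)]
  have [measurable]: "f \<in> borel_measurable borel" unfolding assms(1)[abs_def] by measurable
  have "(LINT t|lborel. (f (m + t) - f (m - t)) / of_real t) = (LINT t|lborel. g (m + t) + g (m - t))"
  proof (rule integral_cong_AE)
    show "AE t in lborel. (f (m + t) - f (m - t)) / of_real t = g (m + t) + g (m - t)"
      using AE_lborel_singleton[of 0]
      by eventually_elim (simp add: assms(1) field_simps)
  qed measurable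
  then show ?thesis
    unfolding hilb_def lborel_integral_symmetrize[OF assms(2), of m] by simp
qed

text \<open>Integration by parts for \<open>(f(m + t) + f(m - t)) / t\<close>, which vanishes at both ends of \<open>(0, \<infinity>)\<close>.\<close>

lemma hilb_deriv_removable:
  assumes f: "lip_decay 2 f" and f': "lip_decay 2 f'"
    and deriv: "\<And>x. (f has_vector_derivative f' x) (at x)"
    and g: "\<And>x. f x = (of_real (x - m))\<^sup>2 * g x" "integrable lborel g"
  shows "hilb f' m = integral\<^sup>L lborel g"
proof -
  note [measurable] = borel_measurable_integrable[OF g(2)] lip_decay_measurable[OF f] lip_decay_measurable[OF f']
  define E where "E t = f (m + t) + f (m - t)" for t
  define E' where "E' t = f' (m + t) - f' (m - t)" for t
  \<comment> \<open>Off 0 this is the derivative of \<open>E t / t\<close>; the term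
    \<open>E t / t^2\<close> is written through \<open>g\<close>, which shows that \<open>p\<close>
    is integrable.\<close>
  define p where "p t = E' t / of_real t - (g (m + t) + g (m - t))" for t
  have [measurable]: "p \<in> borel_measurable borel" unfolding p_def[abs_def] E'_def by measurable
  have E: "(E has_vector_derivative E' t) (at t)" for t
  proof -
    have "((\<lambda>t. m + t) has_vector_derivative 1) (at t)" "((\<lambda>t. m - t) has_vector_derivative -1) (at t)"
      unfolding has_real_derivative_iff_has_vector_derivative[symmetric]
      by (auto intro!: derivative_eq_intros)
    from has_vector_derivative_add[OF vector_diff_chain_at[OF this(1) deriv] vector_diff_chain_at[OF this(2) deriv]]
    show ?thesis by (simp add: E_def[abs_def] E'_def o_def)
  qed
  have ig: "integrable lborel (\<lambda>t. g (m + t) + g (m - t))"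
    using lborel_integrable_real_affine[OF g(2), of 1 m]
      lborel_integrable_real_affine[OF g(2), of "-1" m] by simp
  have ip: "integrable lborel p"
    unfolding p_def E'_def using hilb_integrable[OF f', of m] ig by (rule Bochner_Integration.integrable_diff)
  have p_eq: "p t = E' t / of_real t - E t / (of_real t)\<^sup>2" if "t \<noteq> 0" for t
    using that by (simp add: p_def E_def g(1) add_divide_distrib)
  have h: "integrable lborel (\<lambda>t. indicator {0<..} t *\<^sub>R p t)"
    using ip by (intro integrable_mult_indicator) auto
  have "(LBINT t=0..\<infinity>. p t) = 0 - 0"
  proof (rule interval_integral_FTC_integrable[where F = "\<lambda>t. E t / of_real t"])
    fix t assume "0 < ereal t"
    then have t: "t > 0" by (simp add: zero_ereal_def)
    have "((\<lambda>t. inverse t *\<^sub>R E t) has_vector_derivative (inverse t *\<^sub>R E' t + (- (inverse t)\<^sup>2) *\<^sub>R E t)) (at t)"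
      using t by (intro has_vector_derivative_scaleR E)
        (auto intro!: derivative_eq_intros simp: power2_eq_square)
    then show "((\<lambda>t. E t / of_real t) has_vector_derivative p t) (at t)"
      using t by (simp add: p_eq scaleR_conv_of_real divide_inverse power_inverse mult.commute)
    have "isCont (\<lambda>t. E' t / of_real t - E t / (of_real t)\<^sup>2) t"
      unfolding E'_def E_def
      using t by (intro continuous_intros isCont_o2[OF _ lip_decay_isCont[OF f']] isCont_o2[OF _ lip_decay_isCont[OF f]]) auto
    moreover have "\<forall>\<^sub>F s in nhds t. E' s / of_real s - E s / (of_real s)\<^sup>2 = p s"
      using t1_space_nhds[of t 0] t by (auto elim!: eventually_mono simp: p_eq)
    ultimately show "isCont p t" by (subst (asm) isCont_cong)
  next
    show "set_integrable lborel (einterval 0 \<infinity>) p"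
      using h interval_lebesgue_integral_0_infty[of lborel p]
      by (simp add: set_integrable_def interval_lebesgue_integrable_def)
    \<comment> \<open>Both \<open>E\<close> and its derivative vanish at 0, since
      \<open>f m = 0\<close> and \<open>E'\<close> is odd.\<close>
    have "((\<lambda>t. E t /\<^sub>R norm t) \<longlongrightarrow> 0) (at 0)"
      using E[of 0] g(1)[of m] unfolding has_vector_derivative_def has_derivative_at_within
      by (simp add: E'_def E_def)
    then have "((\<lambda>t. E t /\<^sub>R norm t) \<longlongrightarrow> 0) (at_right 0)"
      by (rule tendsto_mono[rotated]) (simp add: at_le)
    then have "((\<lambda>t. E t / of_real t) \<longlongrightarrow> 0) (at_right 0)"
      by (rule Lim_transform_eventually)
        (auto simp: eventually_at_filter scaleR_conv_of_real divide_inverse mult.commute)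
    then show "(((\<lambda>t. E t / of_real t) \<circ> real_of_ereal) \<longlongrightarrow> 0) (at_right 0)"
      unfolding zero_ereal_def by (simp add: ereal_tendsto_simps)
    obtain C where C: "C \<ge> 0" "\<And>x y. cmod (f x - f y) \<le> C * \<bar>x - y\<bar>"
      "\<And>x. cmod (f x) * (1 + \<bar>x\<bar>)\<^sup>2 \<le> C" "\<And>x. cmod (f x) \<le> C"
      by (rule lip_decayE[OF f]) (rule that)
    have "((\<lambda>t. E t / of_real t) \<longlongrightarrow> 0) at_top"
    proof (rule Lim_null_comparison)
      show "((\<lambda>t::real. 2 * C / t) \<longlongrightarrow> 0) at_top"
        by (intro tendsto_divide_0[OF tendsto_const] filterlim_at_top_imp_at_infinity filterlim_ident)
      show "\<forall>\<^sub>F t in at_top. norm (E t / complex_of_real t) \<le> 2 * C / t"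
        using eventually_gt_at_top[of 0]
      proof eventually_elim
        case (elim t)
        have "cmod (E t) \<le> C + C" unfolding E_def by (intro norm_triangle_mono C)
        with elim show ?case by (simp add: norm_divide divide_right_mono)
      qed
    qed
    then show "(((\<lambda>t. E t / of_real t) \<circ> real_of_ereal) \<longlongrightarrow> 0) (at_left \<infinity>)"
      by (simp add: ereal_tendsto_simps)
  qed auto
  then have "0 = (LINT t|lborel. indicator {0<..} t *\<^sub>R p t)"
    by (simp add: interval_lebesgue_integral_0_infty set_lebesgue_integral_def)
  \<comment> \<open>Since \<open>p\<close> is even, folding at 0 expresses the half-line integral as
    half the integral over the whole line.\<close>
  also have "\<dots> = (LINT t|lborel. indicator {0<..} (0 + t) *\<^sub>R p (0 + t) + indicator {0<..} (0 - t) *\<^sub>R p (0 - t)) / 2"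
    by (rule lborel_integral_symmetrize[OF h])
  also have "(LINT t|lborel. indicator {0<..} (0 + t) *\<^sub>R p (0 + t) + indicator {0<..} (0 - t) *\<^sub>R p (0 - t))
      = integral\<^sup>L lborel p"
  proof (rule integral_cong_AE)
    have even: "p (- t) = p t" for t
      unfolding p_def E'_def by (cases "t = 0") (auto simp: field_simps)
    show "AE t in lborel. indicator {0<..} (0 + t) *\<^sub>R p (0 + t) + indicator {0<..} (0 - t) *\<^sub>R p (0 - t) = p t"
      using AE_lborel_singleton[of 0] by eventually_elim (auto simp: indicator_def even)
  qed measurable
  also have "integral\<^sup>L lborel p = 2 * hilb f' m - 2 * integral\<^sup>L lborel g"
    unfolding p_def E'_def hilb_def lborel_integral_symmetrize[OF g(2), of m]
    using hilb_integrable[OF f', of m] ig by (subst Bochner_Integration.integral_diff) simp_all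
  finally show ?thesis by simp
qed

section \<open>Square-integrable functions and inner products\<close>

lemma L2_bound:
  assumes "f \<in> L2" "g \<in> borel_measurable borel" "\<And>x. cmod (g x) \<le> K * cmod (f x)"
  shows "g \<in> L2"
proof -
  note [measurable] = assms(2)
  have "(cmod (g x))\<^sup>2 \<le> K\<^sup>2 * (cmod (f x))\<^sup>2" for x
    unfolding power_mult_distrib[symmetric] by (rule power_mono[OF assms(3)]) simp
  then have "integrable lborel (\<lambda>x. (cmod (g x))\<^sup>2)"
    using assms(1) unfolding L2_def
    by - (rule Bochner_Integration.integrable_bound[of lborel "\<lambda>x. K\<^sup>2 * (cmod (f x))\<^sup>2"], auto)
  then show ?thesis unfolding L2_def by simp
qed

lemma lip_decay_L2:
  assumes "lip_decay 1 f"
  shows "f \<in> L2"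
proof -
  have "integrable lborel (\<lambda>x. norm (f x * cnj (f x)))"
    by (intro integrable_norm lip_decay_2_integrable lip_decay_mult_cnj assms)
  then show ?thesis
    using lip_decay_measurable[OF assms] unfolding L2_def by (simp add: norm_mult power2_eq_square)
qed

lemma l2_inner_integrable:
  "lip_decay 1 f \<Longrightarrow> lip_decay 1 g \<Longrightarrow> integrable lborel (\<lambda>x. f x * cnj (g x))"
  by (intro lip_decay_2_integrable lip_decay_mult_cnj)

lemma borel_measurable_cnj [measurable]: "cnj \<in> borel_measurable borel"
  by (intro borel_measurable_continuous_onI continuous_intros)

text \<open>Resolvent vectors and projections are fixed only up to null sets; this replaces the
  chosen representatives by explicit ones.\<close>

lemma l2_inner_cong_AE:
  assumes "f \<in> L2" "f' \<in> L2" "g \<in> L2" "g' \<in> L2"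
    and "AE x in lborel. f x = f' x" "AE x in lborel. g x = g' x"
  shows "l2_inner f g = l2_inner f' g'"
  unfolding l2_inner_def
proof (rule integral_cong_AE)
  have [measurable]: "f \<in> borel_measurable borel" "f' \<in> borel_measurable borel"
    "g \<in> borel_measurable borel" "g' \<in> borel_measurable borel"
    using assms(1-4) by (simp_all add: L2_def)
  show "(\<lambda>x. f x * cnj (g x)) \<in> borel_measurable lborel"
    "(\<lambda>x. f' x * cnj (g' x)) \<in> borel_measurable lborel"
    by measurable
  show "AE x in lborel. f x * cnj (g x) = f' x * cnj (g' x)"
    using assms(5,6) by eventually_elim simp
qed

lemma l2_inner_diff_left:
  assumes "lip_decay 1 f" "lip_decay 1 g" "lip_decay 1 w"
  shows "l2_inner (\<lambda>x. f x - c * g x) w = l2_inner f w - c * l2_inner g w"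
  using assms by (simp add: l2_inner_def left_diff_distrib mult.assoc l2_inner_integrable)

lemma l2_inner_mult_left: "l2_inner (\<lambda>x. c * f x) g = c * l2_inner f g"
  by (simp add: l2_inner_def mult.assoc)

lemma l2_inner_mult_right: "l2_inner f (\<lambda>x. c * g x) = cnj c * l2_inner f g"
  by (simp add: l2_inner_def mult.left_commute)

lemma l2_inner_self: "l2_inner f f = of_real ((l2_norm f)\<^sup>2)"
  unfolding l2_inner_def l2_norm_def complex_norm_square[symmetric] integral_complex_of_real
  by (simp add: integral_nonneg_AE)

lemma lip_decay_diff_cmult:
  "lip_decay k f \<Longrightarrow> lip_decay k g \<Longrightarrow> lip_decay k (\<lambda>x. f x - c * g x)"
  using lip_decay_add[of k f "\<lambda>x. - c * g x"] lip_decay_cmult[of k g "- c"] by simp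

section \<open>The rank-one resolvent formula\<close>

text \<open>Both \<open>1 / |x - z|\<close> and \<open>|x| / |x - z|\<close> are bounded in real
  \<open>x\<close>, by \<open>1 / |Im z|\<close> and \<open>1 + |z| / |Im z|\<close>.\<close>

lemma divide_dom_M:
  assumes g: "lip_decay 1 g" and z: "Im z \<noteq> 0"
  shows "(\<lambda>x. g x / (of_real x - z)) \<in> dom_M"
proof -
  note [measurable] = lip_decay_measurable[OF g]
  have Im: "\<bar>Im z\<bar> \<le> cmod (of_real x - z)" for x
    using abs_Im_le_cmod[of "of_real x - z"] by simp
  have pos: "cmod (of_real x - z) > 0" for x using Im[of x] z by linarith
  have 1: "cmod (g x / (of_real x - z)) \<le> (1 / \<bar>Im z\<bar>) * cmod (g x)" for x
    using z Im[of x] pos[of x] by (auto simp: norm_divide intro!: divide_left_mono mult_pos_pos)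
  have 2: "cmod (of_real x * (g x / (of_real x - z))) \<le> (1 + cmod z / \<bar>Im z\<bar>) * cmod (g x)" for x
  proof -
    have "\<bar>x\<bar> \<le> cmod (of_real x - z) + cmod z"
      using norm_triangle_ineq[of "of_real x - z" z] by simp
    also have "cmod z \<le> (cmod z / \<bar>Im z\<bar>) * cmod (of_real x - z)"
      using mult_left_mono[OF Im[of x], of "cmod z / \<bar>Im z\<bar>"] z by simp
    finally have "\<bar>x\<bar> \<le> (1 + cmod z / \<bar>Im z\<bar>) * cmod (of_real x - z)"
      by (simp add: distrib_right)
    then have "\<bar>x\<bar> / cmod (of_real x - z) \<le> 1 + cmod z / \<bar>Im z\<bar>"
      using pos[of x] by (simp only: pos_divide_le_eq)
    from mult_right_mono[OF this, of "cmod (g x)"] show ?thesis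
      by (simp add: norm_mult norm_divide)
  qed
  show ?thesis
    unfolding dom_M_def
    by (intro CollectI conjI L2_bound[OF lip_decay_L2[OF g] _ 1] L2_bound[OF lip_decay_L2[OF g] _ 2])
      measurable
qed

lemma l2_inner_divide:
  assumes "lip_decay 1 v" "lip_decay 1 u" "lip_decay 1 w" "Im z \<noteq> 0"
  shows "l2_inner (\<lambda>x. (v x - a * u x) / (of_real x - z)) w =
    cauchy (\<lambda>x. v x * cnj (w x)) z - a * cauchy (\<lambda>x. u x * cnj (w x)) z"
proof -
  have "l2_inner (\<lambda>x. (v x - a * u x) / (of_real x - z)) w =
      (LINT x|lborel. v x * cnj (w x) / (of_real x - z) - a * (u x * cnj (w x) / (of_real x - z)))"
    unfolding l2_inner_def by (simp add: left_diff_distrib diff_divide_distrib mult.assoc)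
  also have "\<dots> = cauchy (\<lambda>x. v x * cnj (w x)) z - a * cauchy (\<lambda>x. u x * cnj (w x)) z"
    unfolding cauchy_def integral_mult_right_zero[symmetric]
    by (intro Bochner_Integration.integral_diff integrable_mult_right cauchy_integrable
        l2_inner_integrable assms)
  finally show ?thesis .
qed

text \<open>Every solution satisfies \<open>(x - z) f = v - \<alpha> a u\<close> with the number
  \<open>a\<close> equal to the inner product of \<open>f\<close> with \<open>u\<close>. Pairing the
  resulting \<open>f\<close> with \<open>u\<close> gives a linear equation for \<open>a\<close>,
  uniquely solvable because the denominator is nonzero.\<close>

lemma l2_inner_resolvent:
  assumes u: "lip_decay 1 u" and v: "lip_decay 1 v" and w: "lip_decay 1 w" and z: "Im z \<noteq> 0"
    and nz: "1 + of_real \<alpha> * cauchy (\<lambda>x. u x * cnj (u x)) z \<noteq> 0"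
  shows "l2_inner (resolvent u \<alpha> z v) w = cauchy (\<lambda>x. v x * cnj (w x)) z -
    of_real \<alpha> * (cauchy (\<lambda>x. v x * cnj (u x)) z * cauchy (\<lambda>x. u x * cnj (w x)) z
      / (1 + of_real \<alpha> * cauchy (\<lambda>x. u x * cnj (u x)) z))"
proof -
  define c where "c = cauchy (\<lambda>x. v x * cnj (u x)) z / (1 + of_real \<alpha> * cauchy (\<lambda>x. u x * cnj (u x)) z)"
  define F where "F a x = (v x - of_real \<alpha> * a * u x) / (of_real x - z)" for a x
  define sol where "sol f \<longleftrightarrow> f \<in> dom_M \<and> (AE x in lborel. H_op u \<alpha> f x - z * f x = v x)" for f
  have xz: "of_real x - z \<noteq> 0" for x using z by (auto simp: complex_eq_iff)
  have F: "F a \<in> dom_M" for a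
    unfolding F_def[abs_def] by (intro divide_dom_M lip_decay_diff_cmult u v z)
  have inner_F: "l2_inner (F a) g = cauchy (\<lambda>x. v x * cnj (g x)) z
      - of_real \<alpha> * a * cauchy (\<lambda>x. u x * cnj (g x)) z" if "lip_decay 1 g" for a g
    unfolding F_def[abs_def] by (rule l2_inner_divide[OF v u that z])
  have inner_iff: "l2_inner (F a) u = a \<longleftrightarrow> a = c" for a
  proof -
    have "A - r * a * G = a \<longleftrightarrow> a * (1 + r * G) = A" for A r G :: complex
      by (auto simp: algebra_simps)
    then show ?thesis
      unfolding inner_F[OF u] c_def nonzero_eq_divide_eq[OF nz] .
  qed
  \<comment> \<open>Existence of a solution is needed first: it ensures that the choice in
    \<open>resolvent\<close> is itself a solution.\<close>
  have "sol (F c)"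
    unfolding sol_def
  proof (intro conjI F AE_I2)
    fix x
    have "l2_inner (F c) u = c" using inner_iff by blast
    moreover have "(of_real x - z) * F c x = v x - of_real \<alpha> * c * u x"
      using xz[of x] by (simp add: F_def)
    ultimately show "H_op u \<alpha> (F c) x - z * F c x = v x"
      unfolding H_op_def by (simp add: algebra_simps)
  qed
  then have sol: "sol (resolvent u \<alpha> z v)"
    unfolding resolvent_def sol_def[symmetric] by (rule someI[of sol])
  define f where "f = resolvent u \<alpha> z v"
  \<comment> \<open>For the chosen solution, \<open>a\<close> is read off from \<open>f\<close>
    itself; the consistency condition then forces \<open>a = c\<close>.\<close>
  define a where "a = l2_inner f u"
  have f: "f \<in> dom_M" "AE x in lborel. f x = F a x"
  proof -
    show "f \<in> dom_M" using sol unfolding sol_def f_def by blast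
    have "AE x in lborel. H_op u \<alpha> f x - z * f x = v x" using sol unfolding sol_def f_def by blast
    then show "AE x in lborel. f x = F a x"
    proof eventually_elim
      case (elim x)
      then have "(of_real x - z) * f x = v x - of_real \<alpha> * a * u x"
        unfolding H_op_def a_def by (simp add: algebra_simps)
      then show ?case using xz[of x] unfolding F_def by (simp add: nonzero_eq_divide_eq mult.commute)
    qed
  qed
  have inner_f: "l2_inner f g = l2_inner (F a) g" if "lip_decay 1 g" for g
    using f F[of a] lip_decay_L2[OF that] by (intro l2_inner_cong_AE) (auto simp: dom_M_def)
  have "a = c" using inner_f[OF u] inner_iff[of a] unfolding a_def by simp
  then show ?thesis
    unfolding f_def[symmetric] inner_f[OF w] inner_F[OF w] by (simp add: c_def)
qed

section \<open>The eigenspace and its projection\<close>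

text \<open>The eigenvalue equation says that \<open>(x - m) f\<close> is a constant times
  \<open>(x - m) \<phi>\<close>, and off the null set \<open>{m}\<close> the factor cancels.
  Conversely, the normalization of the inner product makes the rank-one term cancel
  \<open>(x - m) \<phi>\<close>.\<close>

lemma eigenspace_eq:
  assumes u: "lip_decay 1 u" and \<phi>: "lip_decay 1 \<phi>"
    and mult: "\<And>x. of_real (x - m) * \<phi> x = u x" and inner: "of_real \<alpha> * l2_inner \<phi> u = -1"
  shows "eigenspace u \<alpha> (of_real m) = {f \<in> L2. \<exists>c. AE x in lborel. f x = c * \<phi> x}"
proof (intro equalityI subsetI)
  fix f assume "f \<in> eigenspace u \<alpha> (of_real m)"
  then have f: "f \<in> L2" "AE x in lborel. H_op u \<alpha> f x = of_real m * f x"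
    unfolding eigenspace_def dom_M_def by auto
  have "AE x in lborel. f x = (- of_real \<alpha> * l2_inner f u) * \<phi> x"
    using f(2) AE_lborel_singleton[of m]
  proof eventually_elim
    case (elim x)
    then have "of_real (x - m) * f x = of_real (x - m) * ((- of_real \<alpha> * l2_inner f u) * \<phi> x)"
      unfolding H_op_def mult[symmetric] by (simp add: algebra_simps)
    moreover have "complex_of_real (x - m) \<noteq> 0" using elim(2) by simp
    ultimately show ?case by (metis mult_left_cancel)
  qed
  with f(1) show "f \<in> {f \<in> L2. \<exists>c. AE x in lborel. f x = c * \<phi> x}" by blast
next
  fix f assume "f \<in> {f \<in> L2. \<exists>c. AE x in lborel. f x = c * \<phi> x}"
  then obtain c where f: "f \<in> L2" "AE x in lborel. f x = c * \<phi> x" by blast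
  have [measurable]: "f \<in> borel_measurable borel" using f(1) by (simp add: L2_def)
  \<comment> \<open>This is \<open>x c \<phi>\<close>, rewritten by
    \<open>x \<phi> = u + m \<phi>\<close> as a combination of square-integrable functions; it puts
    \<open>f\<close> into the domain.\<close>
  let ?g = "\<lambda>x. c * u x - (- of_real m * c) * \<phi> x"
  have g: "?g \<in> L2" by (intro lip_decay_L2 lip_decay_diff_cmult lip_decay_cmult u \<phi>)
  have [measurable]: "?g \<in> borel_measurable borel" using g unfolding L2_def by simp
  have eq: "of_real x * (c * \<phi> x) = ?g x" for x
    unfolding mult[symmetric] by (simp add: algebra_simps)
  have "integrable lborel (\<lambda>x. (cmod (of_real x * f x))\<^sup>2)"
  proof (rule integrable_cong_AE_imp)
    show "integrable lborel (\<lambda>x. (cmod (?g x))\<^sup>2)" using g unfolding L2_def by blast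
    show "AE x in lborel. (cmod (?g x))\<^sup>2 = (cmod (of_real x * f x))\<^sup>2"
      using f(2) by eventually_elim (simp only: eq)
  qed measurable
  then have "f \<in> dom_M" using f(1) unfolding dom_M_def L2_def by simp
  moreover have "l2_inner f u = c * l2_inner \<phi> u"
    using l2_inner_cong_AE[OF f(1) lip_decay_L2[OF lip_decay_cmult[OF \<phi>]] lip_decay_L2[OF u] lip_decay_L2[OF u] f(2)]
    by (simp add: l2_inner_mult_left)
  then have i: "of_real \<alpha> * l2_inner f u = - c" using inner by (simp add: mult.left_commute)
  have "AE x in lborel. H_op u \<alpha> f x = of_real m * f x"
    using f(2)
  proof eventually_elim
    case (elim x)
    show ?case
      unfolding H_op_def i elim mult[of x, symmetric] by (simp add: algebra_simps)
  qed
  ultimately show "f \<in> eigenspace u \<alpha> (of_real m)" unfolding eigenspace_def by blast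
qed

text \<open>The usual formula for projection onto a line. The explicit multiple of \<phi> shows that
  a projection exists; the chosen one is \<open>c \<phi>\<close> almost everywhere, and
  orthogonality against \<phi> determines \<open>c\<close>.\<close>

lemma l2_inner_orth_proj_line:
  assumes v: "lip_decay 1 v" and w: "lip_decay 1 w" and \<phi>: "lip_decay 1 \<phi>" and "l2_norm \<phi> \<noteq> 0"
  shows "l2_inner (orth_proj {f \<in> L2. \<exists>c. AE x in lborel. f x = c * \<phi> x} v) w =
    l2_inner v \<phi> * l2_inner \<phi> w / of_real ((l2_norm \<phi>)\<^sup>2)"
proof -
  define V where "V = {f \<in> L2. \<exists>c. AE x in lborel. f x = c * \<phi> x}"
  define k where "k = l2_inner v \<phi> / of_real ((l2_norm \<phi>)\<^sup>2)"
  define P where "P p \<longleftrightarrow> p \<in> V \<and> (\<forall>e\<in>V. l2_inner (\<lambda>x. v x - p x) e = 0)" for p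
  have L2: "(\<lambda>x. c * \<phi> x) \<in> L2" "(\<lambda>x. v x - c * \<phi> x) \<in> L2" for c
    by (intro lip_decay_L2 lip_decay_cmult lip_decay_diff_cmult v \<phi>)+
  have inner: "l2_inner (\<lambda>x. v x - c * \<phi> x) \<phi> = l2_inner v \<phi> - c * of_real ((l2_norm \<phi>)\<^sup>2)" for c
    unfolding l2_inner_diff_left[OF v \<phi> \<phi>] l2_inner_self ..
  have "P (\<lambda>x. k * \<phi> x)"
    unfolding P_def
  proof (intro conjI ballI)
    show "(\<lambda>x. k * \<phi> x) \<in> V" using L2 unfolding V_def by auto
    fix e assume "e \<in> V"
    then obtain c where e: "e \<in> L2" "AE x in lborel. e x = c * \<phi> x" unfolding V_def by blast
    have "l2_inner (\<lambda>x. v x - k * \<phi> x) e = l2_inner (\<lambda>x. v x - k * \<phi> x) (\<lambda>x. c * \<phi> x)"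
      by (rule l2_inner_cong_AE) (use e L2 in auto)
    also have "\<dots> = 0"
      unfolding l2_inner_mult_right inner k_def using assms(4) by simp
    finally show "l2_inner (\<lambda>x. v x - k * \<phi> x) e = 0" .
  qed
  then have P: "P (orth_proj V v)" unfolding orth_proj_def P_def[symmetric] by (rule someI[of P])
  then obtain c where p: "orth_proj V v \<in> L2" "AE x in lborel. orth_proj V v x = c * \<phi> x"
    unfolding P_def V_def by blast
  have vp: "(\<lambda>x. v x - orth_proj V v x) \<in> L2"
    unfolding L2_def
  proof (intro CollectI conjI)
    have [measurable]: "orth_proj V v \<in> borel_measurable borel" using p(1) by (simp add: L2_def)
    note [measurable] = lip_decay_measurable[OF v]
    show meas: "(\<lambda>x. v x - orth_proj V v x) \<in> borel_measurable lborel" by measurable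
    show "integrable lborel (\<lambda>x. (cmod (v x - orth_proj V v x))\<^sup>2)"
    proof (rule integrable_cong_AE_imp)
      show "integrable lborel (\<lambda>x. (cmod (v x - c * \<phi> x))\<^sup>2)" using L2(2) unfolding L2_def by blast
      show "AE x in lborel. (cmod (v x - c * \<phi> x))\<^sup>2 = (cmod (v x - orth_proj V v x))\<^sup>2"
        using p(2) by eventually_elim simp
    qed (use meas in measurable)
  qed
  have "\<phi> \<in> V" unfolding V_def using L2(1)[of 1] by (auto intro!: exI[of _ 1])
  then have "0 = l2_inner (\<lambda>x. v x - orth_proj V v x) \<phi>" using P unfolding P_def by simp
  also have "\<dots> = l2_inner (\<lambda>x. v x - c * \<phi> x) \<phi>"
    using p(2) L2 vp lip_decay_L2[OF \<phi>] by (intro l2_inner_cong_AE) auto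
  finally have "c * of_real ((l2_norm \<phi>)\<^sup>2) = l2_inner v \<phi>" unfolding inner by simp
  then have "c = k" using assms(4) unfolding k_def by (simp add: nonzero_eq_divide_eq)
  have "l2_inner (orth_proj V v) w = l2_inner (\<lambda>x. c * \<phi> x) w"
    using p L2 lip_decay_L2[OF w] by (intro l2_inner_cong_AE) auto
  then show ?thesis unfolding V_def[symmetric] l2_inner_mult_left \<open>c = k\<close> k_def by simp
qed

section \<open>Boundary values of the resolvent and the spectral density\<close>

text \<open>The Plemelj boundary value of \<open>cauchy f\<close> at \<open>s\<close>, from above
  for \<sigma> = 1 and from below for \<sigma> = -1.\<close>

definition cauchy_limit :: "real \<Rightarrow> (real \<Rightarrow> complex) \<Rightarrow> real \<Rightarrow> complex" where
  "cauchy_limit \<sigma> f s = hilb f s + of_real \<sigma> * \<i> * pi * f s"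

lemma isCont_cauchy_limit: "lip_decay 2 f \<Longrightarrow> isCont (cauchy_limit \<sigma> f) s"
  unfolding cauchy_limit_def by (intro continuous_intros isCont_hilb lip_decay_isCont)

text \<open>
  Boundary values \<open>\<langle>R\<^sub>\<alpha>(s \<plusminus> i0)v, w\<rangle>\<close> of the resolvent, with \<open>\<sigma> = \<plusminus>1\<close>.
\<close>

definition resolvent_limit ::
  "(real \<Rightarrow> complex) \<Rightarrow> (real \<Rightarrow> complex) \<Rightarrow> (real \<Rightarrow> complex) \<Rightarrow> real \<Rightarrow> real \<Rightarrow> real \<Rightarrow> complex"
where
  "resolvent_limit u v w \<sigma> \<alpha> s = cauchy_limit \<sigma> (\<lambda>x. v x * cnj (w x)) s -
    of_real \<alpha> * (cauchy_limit \<sigma> (\<lambda>x. v x * cnj (u x)) s * cauchy_limit \<sigma> (\<lambda>x. u x * cnj (w x)) s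
      / (1 + of_real \<alpha> * cauchy_limit \<sigma> (\<lambda>x. u x * cnj (u x)) s))"

lemma tendsto_l2_inner_resolvent:
  assumes u: "lip_decay 1 u" and v: "lip_decay 1 v" and w: "lip_decay 1 w" and \<sigma>: "\<bar>\<sigma>\<bar> = 1"
    and nz: "1 + of_real \<alpha> * cauchy_limit \<sigma> (\<lambda>x. u x * cnj (u x)) s \<noteq> 0"
  shows "((\<lambda>\<epsilon>. l2_inner (resolvent u \<alpha> (of_real s + of_real \<sigma> * \<i> * of_real \<epsilon>) v) w)
    \<longlongrightarrow> resolvent_limit u v w \<sigma> \<alpha> s) (at_right 0)"
proof -
  define z where "z \<epsilon> = of_real s + of_real \<sigma> * \<i> * complex_of_real \<epsilon>" for \<epsilon>
  have lim: "((\<lambda>\<epsilon>. cauchy (\<lambda>x. f x * cnj (g x)) (z \<epsilon>)) \<longlongrightarrow> cauchy_limit \<sigma> (\<lambda>x. f x * cnj (g x)) s) (at_right 0)"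
    if "lip_decay 1 f" "lip_decay 1 g" for f g
    unfolding cauchy_limit_def z_def by (rule cauchy_boundary_value[OF lip_decay_mult_cnj[OF that] \<sigma>])
  have den: "((\<lambda>\<epsilon>. 1 + of_real \<alpha> * cauchy (\<lambda>x. u x * cnj (u x)) (z \<epsilon>)) \<longlongrightarrow>
      1 + of_real \<alpha> * cauchy_limit \<sigma> (\<lambda>x. u x * cnj (u x)) s) (at_right 0)"
    by (intro tendsto_intros lim u)
  have "((\<lambda>\<epsilon>. cauchy (\<lambda>x. v x * cnj (w x)) (z \<epsilon>) -
    of_real \<alpha> * (cauchy (\<lambda>x. v x * cnj (u x)) (z \<epsilon>) * cauchy (\<lambda>x. u x * cnj (w x)) (z \<epsilon>)
      / (1 + of_real \<alpha> * cauchy (\<lambda>x. u x * cnj (u x)) (z \<epsilon>)))) \<longlongrightarrow> resolvent_limit u v w \<sigma> \<alpha> s) (at_right 0)"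
    unfolding resolvent_limit_def by (intro tendsto_intros lim u v w nz)
  \<comment> \<open>The denominator has a nonzero limit, hence is nonzero for small \<epsilon>, and
    the resolvent formula applies there.\<close>
  moreover have "\<forall>\<^sub>F \<epsilon> in at_right 0. cauchy (\<lambda>x. v x * cnj (w x)) (z \<epsilon>) -
    of_real \<alpha> * (cauchy (\<lambda>x. v x * cnj (u x)) (z \<epsilon>) * cauchy (\<lambda>x. u x * cnj (w x)) (z \<epsilon>)
      / (1 + of_real \<alpha> * cauchy (\<lambda>x. u x * cnj (u x)) (z \<epsilon>))) = l2_inner (resolvent u \<alpha> (z \<epsilon>) v) w"
    using tendsto_imp_eventually_ne[OF den nz] eventually_at_right_less[of 0]
  proof eventually_elim
    case (elim \<epsilon>)
    have "Im (z \<epsilon>) \<noteq> 0" using elim(2) \<sigma> by (auto simp: z_def)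
    from l2_inner_resolvent[OF u v w this elim(1)] show ?case by simp
  qed
  ultimately show ?thesis
    unfolding z_def[symmetric] by (rule Lim_transform_eventually)
qed

lemma spec_density_eq:
  assumes u: "lip_decay 1 u" and v: "lip_decay 1 v" and w: "lip_decay 1 w"
    and nz: "1 + of_real \<alpha> * cauchy_limit 1 (\<lambda>x. u x * cnj (u x)) s \<noteq> 0"
      "1 + of_real \<alpha> * cauchy_limit (-1) (\<lambda>x. u x * cnj (u x)) s \<noteq> 0"
  shows "spec_density u v w \<alpha> s =
    1 / (2 * of_real pi * \<i>) * (resolvent_limit u v w 1 \<alpha> s - resolvent_limit u v w (-1) \<alpha> s)"
  unfolding spec_density_def
proof (rule tendsto_Lim)
  have p: "((\<lambda>\<epsilon>. l2_inner (resolvent u \<alpha> (of_real s + \<i> * of_real \<epsilon>) v) w)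
    \<longlongrightarrow> resolvent_limit u v w 1 \<alpha> s) (at_right 0)"
    using tendsto_l2_inner_resolvent[OF u v w _ nz(1)] by simp
  have m: "((\<lambda>\<epsilon>. l2_inner (resolvent u \<alpha> (of_real s - \<i> * of_real \<epsilon>) v) w)
    \<longlongrightarrow> resolvent_limit u v w (-1) \<alpha> s) (at_right 0)"
    using tendsto_l2_inner_resolvent[OF u v w _ nz(2)] by simp
  show "((\<lambda>\<epsilon>. 1 / (2 * of_real pi * \<i>) *
       (l2_inner (resolvent u \<alpha> (of_real s + \<i> * of_real \<epsilon>) v) w
        - l2_inner (resolvent u \<alpha> (of_real s - \<i> * of_real \<epsilon>) v) w)) \<longlongrightarrow>
    1 / (2 * of_real pi * \<i>) * (resolvent_limit u v w 1 \<alpha> s - resolvent_limit u v w (-1) \<alpha> s)) (at_right 0)"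
    by (intro tendsto_intros p m)
qed simp

section \<open>The limit along the resonance curve\<close>

text \<open>The Lorentz profile arises from
  \<open>1 / (h - i) - 1 / (h + i) = 2 i / (h^2 + 1)\<close>. Here \<open>b\<close> stands for the
  product of the two inner products and \<open>N\<close> for the squared norm of
  \<open>phi\<close>.\<close>

lemma resonance_identity:
  fixes N h a :: real and b :: complex
  assumes "N \<noteq> 0" "a \<noteq> 0"
  shows "1 / (2 * of_real pi * \<i>) *
      ((0 - of_real a * (b / (of_real a * (of_real h * of_real N + of_real 1 * \<i> * of_real N)))) -
       (0 - of_real a * (b / (of_real a * (of_real h * of_real N + of_real (-1) * \<i> * of_real N))))) =
    of_real (1 / pi * (1 / (h\<^sup>2 + 1))) * (b / of_real N)"
proof -
  have nz: "of_real h + \<i> \<noteq> 0" "of_real h - \<i> \<noteq> 0" by (auto simp: complex_eq_iff)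
  have prod: "(of_real h + \<i>) * (of_real h - \<i>) = of_real (h\<^sup>2 + 1)"
    by (simp add: power2_eq_square algebra_simps)
  have *: "of_real a * (b / (of_real a * (of_real h * of_real N + of_real \<sigma> * \<i> * of_real N))) =
      b / of_real N * (1 / (of_real h + of_real \<sigma> * \<i>))" for \<sigma>
  proof -
    have "complex_of_real h * of_real N + of_real \<sigma> * \<i> * of_real N = of_real N * (of_real h + of_real \<sigma> * \<i>)"
      by (simp add: algebra_simps)
    then show ?thesis using assms by simp
  qed
  have "1 / (of_real h - \<i>) - 1 / (of_real h + \<i>) = 2 * \<i> / of_real (h\<^sup>2 + 1)"
    unfolding prod[symmetric] using nz by (simp add: divide_simps)
  then have "1 / (2 * of_real pi * \<i>) * (b / of_real N * (1 / (of_real h - \<i>) - 1 / (of_real h + \<i>)))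
      = of_real (1 / pi * (1 / (h\<^sup>2 + 1))) * (b / of_real N)"
    by simp
  then show ?thesis unfolding * by (simp add: right_diff_distrib)
qed

text \<open>The hypotheses on \<open>v\<close> and \<open>w\<close> are weak enough to admit
  \<open>v = w = phi\<close>. The two further conclusions arise on the way and serve to identify the
  eigenspace and its projection.\<close>

lemma tendsto_kappa_spec_density:
  fixes \<alpha>\<^sub>0 \<mu>\<^sub>0 h :: real
  assumes u: "lip_decay 1 u" and u': "lip_decay 1 u'"
    and deriv: "\<And>x. (u has_vector_derivative u' x) (at x)"
    and zero: "\<And>x. u x = 0 \<longleftrightarrow> x = \<mu>\<^sub>0"
    and F1: "F1 u \<alpha>\<^sub>0 \<mu>\<^sub>0 = 0"
    and lam: "(lam \<longlongrightarrow> \<mu>\<^sub>0) (at \<alpha>\<^sub>0)" "\<forall>\<^sub>F \<alpha> in at \<alpha>\<^sub>0. F1 u \<alpha> (lam \<alpha>) = 0"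
    and v: "lip_decay 1 v" and w: "lip_decay 1 w"
  shows "((\<lambda>\<alpha>. of_real (kappa u \<mu>\<^sub>0 lam \<alpha>) * spec_density u v w \<alpha> (lam_h u \<mu>\<^sub>0 lam h \<alpha>))
      \<longlongrightarrow> of_real (1 / pi * (1 / (h\<^sup>2 + 1))) *
        (l2_inner v (phi u \<mu>\<^sub>0) * l2_inner (phi u \<mu>\<^sub>0) w / of_real ((l2_norm (phi u \<mu>\<^sub>0))\<^sup>2))) (at \<alpha>\<^sub>0)"
    and "of_real \<alpha>\<^sub>0 * l2_inner (phi u \<mu>\<^sub>0) u = -1" and "l2_norm (phi u \<mu>\<^sub>0) \<noteq> 0"
proof -
  define \<phi> where "\<phi> = phi u \<mu>\<^sub>0"
  define N where "N = (l2_norm \<phi>)\<^sup>2"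
  define D where "D x = u x * cnj (u x)" for x
  define D' where "D' x = u' x * cnj (u x) + u x * cnj (u' x)" for x
  have \<phi>: "lip_decay 1 \<phi>" unfolding \<phi>_def by (rule phi_lip_decay[OF u u' deriv]) (simp add: zero)
  have mult: "u x = of_real (x - \<mu>\<^sub>0) * \<phi> x" for x unfolding \<phi>_def by (rule phi_mult[symmetric]) (simp add: zero)
  have D: "lip_decay 2 D" unfolding D_def[abs_def] by (intro lip_decay_mult_cnj u)
  have D': "lip_decay 2 D'" unfolding D'_def[abs_def] by (intro lip_decay_add lip_decay_mult_cnj u u')
  have D_deriv: "(D has_vector_derivative D' x) (at x)" for x
    using has_vector_derivative_mult[OF deriv[of x] has_vector_derivative_cnj[OF deriv[of x]]]
    unfolding D_def[abs_def] D'_def by (simp add: add.commute)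
  have F1_eq: "F1 u \<alpha> s = 1 + of_real \<alpha> * hilb D s" for \<alpha> s
    unfolding F1_def complex_norm_square D_def[abs_def, symmetric] pv_gamma_eq_hilb[OF D] ..
  have removable: "hilb (\<lambda>x. f x * cnj (u x)) \<mu>\<^sub>0 = l2_inner f \<phi>" "hilb (\<lambda>x. u x * cnj (f x)) \<mu>\<^sub>0 = l2_inner \<phi> f"
    if "lip_decay 1 f" for f
    unfolding l2_inner_def
    by (rule hilb_removable[OF _ l2_inner_integrable[OF that \<phi>]],
        simp add: mult mult.left_commute)
      (rule hilb_removable[OF _ l2_inner_integrable[OF \<phi> that]], simp add: mult)
  \<comment> \<open>At \<open>\<mu>\<^sub>0\<close> the principal value of \<open>|u|^2\<close> is
    the inner product of \<phi> with \<open>u\<close>, so this is the equation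
    \<open>F1 = 0\<close>.\<close>
  show inner: "of_real \<alpha>\<^sub>0 * l2_inner (phi u \<mu>\<^sub>0) u = -1"
    using F1 removable(2)[OF u] unfolding F1_eq D_def[abs_def, symmetric] \<phi>_def[symmetric]
    by (simp add: add_eq_0_iff)
  then have "\<alpha>\<^sub>0 \<noteq> 0" by auto
  show norm: "l2_norm (phi u \<mu>\<^sub>0) \<noteq> 0"
  proof
    assume "l2_norm (phi u \<mu>\<^sub>0) = 0"
    moreover have "integrable lborel (\<lambda>x. (cmod (\<phi> x))\<^sup>2)"
      using lip_decay_L2[OF \<phi>] unfolding L2_def by blast
    ultimately have "AE x in lborel. (cmod (\<phi> x))\<^sup>2 = 0"
      using integral_nonneg_eq_0_iff_AE[of lborel "\<lambda>x. (cmod (\<phi> x))\<^sup>2"]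
      by (simp add: l2_norm_def \<phi>_def)
    then have "AE x in lborel. \<phi> x * cnj (u x) = 0" by eventually_elim simp
    then have "l2_inner \<phi> u = 0" unfolding l2_inner_def by (rule integral_eq_zero_AE)
    with inner show False unfolding \<phi>_def by simp
  qed
  then have N: "N > 0" unfolding N_def \<phi>_def by simp
  define \<kappa> where "\<kappa> \<alpha> = kappa u \<mu>\<^sub>0 lam \<alpha>" for \<alpha>
  define b where "b \<alpha> = lam \<alpha> + h * \<kappa> \<alpha>" for \<alpha>
  have b_eq: "lam_h u \<mu>\<^sub>0 lam h \<alpha> = b \<alpha>" for \<alpha> unfolding lam_h_def b_def \<kappa>_def ..
  have \<kappa>_eq: "\<kappa> \<alpha> = pi * (cmod (u (lam \<alpha>)))\<^sup>2 / N" for \<alpha> unfolding \<kappa>_def kappa_def N_def \<phi>_def ..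
  have D_lam: "D (lam \<alpha>) = of_real (\<kappa> \<alpha>) * of_real (N / pi)" for \<alpha>
    using N unfolding D_def complex_norm_square[symmetric] \<kappa>_eq by simp
  have "((\<lambda>\<alpha>. pi * (cmod (u (lam \<alpha>)))\<^sup>2 / N) \<longlongrightarrow> pi * (cmod (u \<mu>\<^sub>0))\<^sup>2 / N) (at \<alpha>\<^sub>0)"
    using N by (intro tendsto_intros isCont_tendsto_compose[OF lip_decay_isCont[OF u]] lam) auto
  then have \<kappa>_0: "(\<kappa> \<longlongrightarrow> 0) (at \<alpha>\<^sub>0)"
    unfolding \<kappa>_eq[abs_def] using zero[of \<mu>\<^sub>0] by simp
  \<comment> \<open>If the curve returned to \<open>\<mu>\<^sub>0\<close> at \<alpha>, then \<alpha>
    and \<open>\<alpha>\<^sub>0\<close> would have the same product -1 with the same number, and so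
    coincide. Thus \<open>u\<close> is nonzero at \<open>lam \<alpha>\<close>.\<close>
  have \<kappa>_ne: "\<forall>\<^sub>F \<alpha> in at \<alpha>\<^sub>0. \<kappa> \<alpha> \<noteq> 0"
    using lam(2) eventually_neq_at_within[of \<alpha>\<^sub>0]
  proof eventually_elim
    case (elim \<alpha>)
    have "lam \<alpha> \<noteq> \<mu>\<^sub>0"
    proof
      assume "lam \<alpha> = \<mu>\<^sub>0"
      with elim(1) F1 have "of_real \<alpha> * hilb D \<mu>\<^sub>0 = -1" "of_real \<alpha>\<^sub>0 * hilb D \<mu>\<^sub>0 = -1"
        unfolding F1_eq by (simp_all add: add_eq_0_iff)
      then have "complex_of_real \<alpha> = of_real \<alpha>\<^sub>0" by (metis mult_cancel_right mult_zero_right zero_neq_neg_one)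
      with elim(2) show False by simp
    qed
    then show ?case using zero N by (simp add: \<kappa>_eq)
  qed
  have b_lim: "(b \<longlongrightarrow> \<mu>\<^sub>0) (at \<alpha>\<^sub>0)"
    using tendsto_add[OF lam(1) tendsto_mult[OF tendsto_const \<kappa>_0, of h]] by (simp add: b_def[abs_def])
  have \<alpha>: "((\<lambda>\<alpha>. complex_of_real \<alpha>) \<longlongrightarrow> of_real \<alpha>\<^sub>0) (at \<alpha>\<^sub>0)" by (intro tendsto_intros)
  \<comment> \<open>The derivative of the principal value at \<open>\<mu>\<^sub>0\<close>, from
    \<open>D = (x - \<mu>\<^sub>0)^2 |\<phi>|^2\<close>.\<close>
  have "hilb D' \<mu>\<^sub>0 = of_real N"
  proof -
    have "hilb D' \<mu>\<^sub>0 = (LINT x|lborel. \<phi> x * cnj (\<phi> x))"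
      by (rule hilb_deriv_removable[OF D D' D_deriv _ l2_inner_integrable[OF \<phi> \<phi>]])
        (simp add: D_def mult power2_eq_square)
    then show ?thesis using l2_inner_self[of \<phi>] unfolding l2_inner_def N_def by simp
  qed
  with C1_increment_tendsto[OF hilb_has_vector_derivative[OF D D' D_deriv] isCont_hilb[OF D'] lam(1) \<kappa>_0 \<kappa>_ne, of h]
  have hilb_incr: "((\<lambda>\<alpha>. (hilb D (b \<alpha>) - hilb D (lam \<alpha>)) / of_real (\<kappa> \<alpha>)) \<longlongrightarrow> of_real h * of_real N) (at \<alpha>\<^sub>0)"
    unfolding b_def by simp
  \<comment> \<open>Since \<open>D'\<close> vanishes at \<open>\<mu>\<^sub>0\<close>, the increment
    of \<open>D\<close> from \<open>lam \<alpha>\<close> to \<open>b \<alpha>\<close> is of smaller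
    order than \<kappa>; only \<open>D (lam \<alpha>) / \<kappa> = N / \<pi>\<close>
    survives.\<close>
  have "D' \<mu>\<^sub>0 = 0" using zero[of \<mu>\<^sub>0] by (simp add: D'_def)
  with C1_increment_tendsto[OF D_deriv lip_decay_isCont[OF D'] lam(1) \<kappa>_0 \<kappa>_ne, of h]
  have "((\<lambda>\<alpha>. (D (b \<alpha>) - D (lam \<alpha>)) / of_real (\<kappa> \<alpha>) + of_real (N / pi)) \<longlongrightarrow> 0 + of_real (N / pi)) (at \<alpha>\<^sub>0)"
    unfolding b_def by (intro tendsto_intros) simp
  moreover have "\<forall>\<^sub>F \<alpha> in at \<alpha>\<^sub>0. (D (b \<alpha>) - D (lam \<alpha>)) / of_real (\<kappa> \<alpha>) + of_real (N / pi) = D (b \<alpha>) / of_real (\<kappa> \<alpha>)"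
    using \<kappa>_ne by eventually_elim (simp add: D_lam diff_divide_distrib)
  ultimately have D_b: "((\<lambda>\<alpha>. D (b \<alpha>) / of_real (\<kappa> \<alpha>)) \<longlongrightarrow> of_real (N / pi)) (at \<alpha>\<^sub>0)"
    using Lim_transform_eventually by fastforce
  define E where "E \<sigma> \<alpha> = (1 + of_real \<alpha> * cauchy_limit \<sigma> D (b \<alpha>)) / of_real (\<kappa> \<alpha>)" for \<sigma> \<alpha>
  define e where "e \<sigma> = of_real \<alpha>\<^sub>0 * (of_real h * of_real N + of_real \<sigma> * \<i> * of_real N)" for \<sigma> :: real
  have E: "(E \<sigma> \<longlongrightarrow> e \<sigma>) (at \<alpha>\<^sub>0)" for \<sigma>
  proof (rule Lim_transform_eventually)
    have "((\<lambda>\<alpha>. of_real \<alpha> * ((hilb D (b \<alpha>) - hilb D (lam \<alpha>)) / of_real (\<kappa> \<alpha>) +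
        of_real \<sigma> * \<i> * pi * (D (b \<alpha>) / of_real (\<kappa> \<alpha>)))) \<longlongrightarrow>
      of_real \<alpha>\<^sub>0 * (of_real h * of_real N + of_real \<sigma> * \<i> * pi * of_real (N / pi))) (at \<alpha>\<^sub>0)"
      by (intro tendsto_intros \<alpha> hilb_incr D_b)
    then show "((\<lambda>\<alpha>. of_real \<alpha> * ((hilb D (b \<alpha>) - hilb D (lam \<alpha>)) / of_real (\<kappa> \<alpha>) +
        of_real \<sigma> * \<i> * pi * (D (b \<alpha>) / of_real (\<kappa> \<alpha>)))) \<longlongrightarrow> e \<sigma>) (at \<alpha>\<^sub>0)"
      by (simp add: e_def mult.assoc)
    show "\<forall>\<^sub>F \<alpha> in at \<alpha>\<^sub>0. of_real \<alpha> * ((hilb D (b \<alpha>) - hilb D (lam \<alpha>)) / of_real (\<kappa> \<alpha>) +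
        of_real \<sigma> * \<i> * pi * (D (b \<alpha>) / of_real (\<kappa> \<alpha>))) = E \<sigma> \<alpha>"
      using lam(2)
    proof eventually_elim
      case (elim \<alpha>)
      \<comment> \<open>Subtracting the equation of the curve leaves only the increment of
        \<open>hilb D\<close> and the local term.\<close>
      have "1 + of_real \<alpha> * cauchy_limit \<sigma> D (b \<alpha>) = F1 u \<alpha> (lam \<alpha>) +
          of_real \<alpha> * ((hilb D (b \<alpha>) - hilb D (lam \<alpha>)) + of_real \<sigma> * \<i> * pi * D (b \<alpha>))"
        unfolding cauchy_limit_def F1_eq by (simp add: algebra_simps)
      then show ?case unfolding E_def elim by (simp add: add_divide_distrib[symmetric])
    qed
  qed
  have e_ne: "e \<sigma> \<noteq> 0" if "\<bar>\<sigma>\<bar> = 1" for \<sigma>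
    using N \<open>\<alpha>\<^sub>0 \<noteq> 0\<close> that by (auto simp: e_def complex_eq_iff)
  \<comment> \<open>This is \<kappa> times the resolvent limit, with \<kappa> moved into the
    denominator of the rank-one term. The free term tends to 0.\<close>
  define Q where "Q \<sigma> \<alpha> = of_real (\<kappa> \<alpha>) * cauchy_limit \<sigma> (\<lambda>x. v x * cnj (w x)) (b \<alpha>) -
    of_real \<alpha> * (cauchy_limit \<sigma> (\<lambda>x. v x * cnj (u x)) (b \<alpha>) * cauchy_limit \<sigma> (\<lambda>x. u x * cnj (w x)) (b \<alpha>)
      / E \<sigma> \<alpha>)" for \<sigma> \<alpha>
  have Q: "(Q \<sigma> \<longlongrightarrow> 0 - of_real \<alpha>\<^sub>0 * (l2_inner v \<phi> * l2_inner \<phi> w / e \<sigma>)) (at \<alpha>\<^sub>0)" if \<sigma>: "\<bar>\<sigma>\<bar> = 1" for \<sigma>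
  proof -
    have cl: "((\<lambda>\<alpha>. cauchy_limit \<sigma> (\<lambda>x. f x * cnj (g x)) (b \<alpha>)) \<longlongrightarrow> cauchy_limit \<sigma> (\<lambda>x. f x * cnj (g x)) \<mu>\<^sub>0) (at \<alpha>\<^sub>0)"
      if "lip_decay 1 f" "lip_decay 1 g" for f g
      by (rule isCont_tendsto_compose[OF isCont_cauchy_limit[OF lip_decay_mult_cnj[OF that]] b_lim])
    \<comment> \<open>The local Plemelj terms vanish because \<open>u\<close> is zero at
      \<open>\<mu>\<^sub>0\<close>, so both half-planes give the same numerators.\<close>
    have "cauchy_limit \<sigma> (\<lambda>x. v x * cnj (u x)) \<mu>\<^sub>0 = l2_inner v \<phi>"
      "cauchy_limit \<sigma> (\<lambda>x. u x * cnj (w x)) \<mu>\<^sub>0 = l2_inner \<phi> w"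
      using zero[of \<mu>\<^sub>0] by (simp_all add: cauchy_limit_def removable(1)[OF v] removable(2)[OF w])
    moreover have "(Q \<sigma> \<longlongrightarrow> of_real 0 * cauchy_limit \<sigma> (\<lambda>x. v x * cnj (w x)) \<mu>\<^sub>0 -
      of_real \<alpha>\<^sub>0 * (cauchy_limit \<sigma> (\<lambda>x. v x * cnj (u x)) \<mu>\<^sub>0 * cauchy_limit \<sigma> (\<lambda>x. u x * cnj (w x)) \<mu>\<^sub>0
        / e \<sigma>)) (at \<alpha>\<^sub>0)"
      unfolding Q_def[abs_def] by (intro tendsto_intros cl \<alpha> \<kappa>_0 E e_ne \<sigma> u v w)
    ultimately show ?thesis by simp
  qed
  have "((\<lambda>\<alpha>. 1 / (2 * of_real pi * \<i>) * (Q 1 \<alpha> - Q (-1) \<alpha>)) \<longlongrightarrow> 1 / (2 * of_real pi * \<i>) *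
      ((0 - of_real \<alpha>\<^sub>0 * (l2_inner v \<phi> * l2_inner \<phi> w / e 1)) -
       (0 - of_real \<alpha>\<^sub>0 * (l2_inner v \<phi> * l2_inner \<phi> w / e (-1))))) (at \<alpha>\<^sub>0)"
    by (intro tendsto_intros Q) auto
  also have "1 / (2 * of_real pi * \<i>) *
      ((0 - of_real \<alpha>\<^sub>0 * (l2_inner v \<phi> * l2_inner \<phi> w / e 1)) -
       (0 - of_real \<alpha>\<^sub>0 * (l2_inner v \<phi> * l2_inner \<phi> w / e (-1)))) =
      of_real (1 / pi * (1 / (h\<^sup>2 + 1))) * (l2_inner v \<phi> * l2_inner \<phi> w / of_real N)"
    unfolding e_def using N \<open>\<alpha>\<^sub>0 \<noteq> 0\<close> by (intro resonance_identity) auto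
  finally have lim: "((\<lambda>\<alpha>. 1 / (2 * of_real pi * \<i>) * (Q 1 \<alpha> - Q (-1) \<alpha>)) \<longlongrightarrow>
      of_real (1 / pi * (1 / (h\<^sup>2 + 1))) * (l2_inner v \<phi> * l2_inner \<phi> w / of_real N)) (at \<alpha>\<^sub>0)" .
  \<comment> \<open>The limits \<open>e 1\<close> and \<open>e (-1)\<close> are nonzero, so both
    denominators are eventually nonzero, as the formula for the density requires.\<close>
  have "\<forall>\<^sub>F \<alpha> in at \<alpha>\<^sub>0. E 1 \<alpha> \<noteq> 0" "\<forall>\<^sub>F \<alpha> in at \<alpha>\<^sub>0. E (-1) \<alpha> \<noteq> 0"
    by (rule tendsto_imp_eventually_ne[OF E e_ne]; simp)+
  with \<kappa>_ne have "\<forall>\<^sub>F \<alpha> in at \<alpha>\<^sub>0. 1 / (2 * of_real pi * \<i>) * (Q 1 \<alpha> - Q (-1) \<alpha>) =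
      of_real (\<kappa> \<alpha>) * spec_density u v w \<alpha> (b \<alpha>)"
  proof eventually_elim
    case (elim \<alpha>)
    have "of_real (\<kappa> \<alpha>) * resolvent_limit u v w \<sigma> \<alpha> (b \<alpha>) = Q \<sigma> \<alpha>" for \<sigma>
      unfolding Q_def resolvent_limit_def E_def D_def[abs_def] by (simp add: right_diff_distrib)
    moreover have "spec_density u v w \<alpha> (b \<alpha>) =
      1 / (2 * of_real pi * \<i>) * (resolvent_limit u v w 1 \<alpha> (b \<alpha>) - resolvent_limit u v w (-1) \<alpha> (b \<alpha>))"
      by (rule spec_density_eq[OF u v w]) (use elim in \<open>auto simp: E_def D_def[abs_def]\<close>)
    ultimately show ?case by (simp add: right_diff_distrib mult.left_commute flip: \<open>\<And>\<sigma>. _ = Q \<sigma> \<alpha>\<close>)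
  qed
  from Lim_transform_eventually[OF lim this]
  show "((\<lambda>\<alpha>. of_real (kappa u \<mu>\<^sub>0 lam \<alpha>) * spec_density u v w \<alpha> (lam_h u \<mu>\<^sub>0 lam h \<alpha>))
      \<longlongrightarrow> of_real (1 / pi * (1 / (h\<^sup>2 + 1))) *
        (l2_inner v (phi u \<mu>\<^sub>0) * l2_inner (phi u \<mu>\<^sub>0) w / of_real ((l2_norm (phi u \<mu>\<^sub>0))\<^sup>2))) (at \<alpha>\<^sub>0)"
    unfolding b_eq \<kappa>_def N_def \<phi>_def .
qed

theorem theorem4p3:
  fixes \<alpha>\<^sub>0 \<mu>\<^sub>0 h :: real
    and u v w :: "real \<Rightarrow> complex"
    and J :: "real set" and lam :: "real \<Rightarrow> real"
  assumes "u \<in> schwartz"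
    and "l2_norm u = 1"
    and "\<And>x. u x = 0 \<longleftrightarrow> x = \<mu>\<^sub>0"
    and "1 + of_real \<alpha>\<^sub>0 * pv_gamma (\<lambda>x. of_real ((cmod (u x))\<^sup>2)) \<mu>\<^sub>0 = 0"
    and "open J" and "is_interval J" and "\<alpha>\<^sub>0 \<in> J"
    and "lam C1_differentiable_on J"
    and "lam \<alpha>\<^sub>0 = \<mu>\<^sub>0"
    and "\<And>\<alpha>. \<alpha> \<in> J \<Longrightarrow> F1 u \<alpha> (lam \<alpha>) = 0"
    and "v \<in> schwartz" and "w \<in> schwartz"
  shows "((\<lambda>\<alpha>. of_real (kappa u \<mu>\<^sub>0 lam \<alpha>) * spec_density u v w \<alpha> (lam_h u \<mu>\<^sub>0 lam h \<alpha>))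
            \<longlongrightarrow> of_real (1 / pi * (1 / (h\<^sup>2 + 1)))
                * l2_inner (orth_proj (eigenspace u \<alpha>\<^sub>0 (of_real \<mu>\<^sub>0)) v) w) (at \<alpha>\<^sub>0)
       \<and> ((\<lambda>\<alpha>. of_real (kappa u \<mu>\<^sub>0 lam \<alpha>) *
              spec_density u (phi u \<mu>\<^sub>0) (phi u \<mu>\<^sub>0) \<alpha> (lam_h u \<mu>\<^sub>0 lam h \<alpha>))
            \<longlongrightarrow> of_real ((l2_norm (phi u \<mu>\<^sub>0))\<^sup>2 / pi * (1 / (h\<^sup>2 + 1)))) (at \<alpha>\<^sub>0)"
proof (intro conjI)
  define u' where "u' x = vector_derivative u (at x)" for x
  have u: "lip_decay 1 u" and u': "lip_decay 1 u'"
    and deriv: "\<And>x. (u has_vector_derivative u' x) (at x)"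
    unfolding u'_def[abs_def]
    by (intro schwartz_lip_decay schwartz_vector_derivative schwartz_has_vector_derivative assms(1))+
  have v: "lip_decay 1 v" and w: "lip_decay 1 w"
    by (intro schwartz_lip_decay assms)+
  have \<phi>: "lip_decay 1 (phi u \<mu>\<^sub>0)"
    by (rule phi_lip_decay[OF u u' deriv]) (simp add: assms(3))
  have F1: "F1 u \<alpha>\<^sub>0 \<mu>\<^sub>0 = 0" using assms(4) unfolding F1_def .
  have "isCont lam \<alpha>\<^sub>0"
    using C1_differentiable_imp_continuous_on[OF assms(8)] assms(5,7)
    by (simp add: continuous_on_eq_continuous_at)
  then have lam: "(lam \<longlongrightarrow> \<mu>\<^sub>0) (at \<alpha>\<^sub>0)" using assms(9) by (simp add: isCont_def)
  have curve: "\<forall>\<^sub>F \<alpha> in at \<alpha>\<^sub>0. F1 u \<alpha> (lam \<alpha>) = 0"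
    using eventually_at_in_open'[OF assms(5,7)] by eventually_elim (rule assms(10))
  note main = tendsto_kappa_spec_density[OF u u' deriv assms(3) F1 lam curve]
  have eig: "eigenspace u \<alpha>\<^sub>0 (of_real \<mu>\<^sub>0) = {f \<in> L2. \<exists>c. AE x in lborel. f x = c * phi u \<mu>\<^sub>0 x}"
    using assms(3) by (intro eigenspace_eq u \<phi> phi_mult main(2)[OF v w]) simp
  show "((\<lambda>\<alpha>. of_real (kappa u \<mu>\<^sub>0 lam \<alpha>) * spec_density u v w \<alpha> (lam_h u \<mu>\<^sub>0 lam h \<alpha>))
            \<longlongrightarrow> of_real (1 / pi * (1 / (h\<^sup>2 + 1)))
                * l2_inner (orth_proj (eigenspace u \<alpha>\<^sub>0 (of_real \<mu>\<^sub>0)) v) w) (at \<alpha>\<^sub>0)"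
    unfolding eig l2_inner_orth_proj_line[OF v w \<phi> main(3)[OF v w]] by (rule main(1)[OF v w])
  \<comment> \<open>With \<open>v = w = phi\<close> the numerator is the squared norm twice, and one
    factor cancels.\<close>
  show "((\<lambda>\<alpha>. of_real (kappa u \<mu>\<^sub>0 lam \<alpha>) *
              spec_density u (phi u \<mu>\<^sub>0) (phi u \<mu>\<^sub>0) \<alpha> (lam_h u \<mu>\<^sub>0 lam h \<alpha>))
            \<longlongrightarrow> of_real ((l2_norm (phi u \<mu>\<^sub>0))\<^sup>2 / pi * (1 / (h\<^sup>2 + 1)))) (at \<alpha>\<^sub>0)"
    using main(1)[OF \<phi> \<phi>, of h] main(3)[OF v w] unfolding l2_inner_self
    by (simp add: power2_eq_square)
qed

end
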